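(* We have $\dfrac{\mathrm{Vol}(U_3)}{\mathrm{Vol}(\mathbb{B}^3)}=0.8029702551499\dots$ (i.e. the decimal expansion of this ratio begins with these digits), and moreover $$\mathrm{Vol}(U_3)=\frac{4\pi}{3}\bigl(4-\sqrt{6}\bigr)+24\left(2-\sqrt{2}-\arctan\frac{1}{\sqrt{8}}\right)-96\int_{0}^{\frac{1}{\sqrt{3}}}\sqrt{\frac{1+a^2}{1-a^2}}\,\arctan\left(\frac{a}{\sqrt{1+a^2}+1}\right)\mathrm{d}a.$$
   Context: $\mathbb{E}^n$ denotes $n$-dimensional Euclidean space with Euclidean norm $|\cdot|$, $\mathbb{E}^n_+$ is the subset of $\mathbb{E}^n$ consisting of the points all of whose coordinates are non-negative, and $\mathbb{B}^3$ is the unit ball in $\mathbb{E}^3$. Define $$M_4:=\bigl\{v-w \mid v,w\in\mathbb{E}^4_+,\ |v|^2+\bigl(|w|+\sqrt{2}\bigr)^2\le 4\bigr\}\subset\mathbb{E}^4.$$ $U_3$ is the orthogonal projection of $M_4$ onto the $3$-dimensional subspace $(1,1,1,1)^\perp$ of $\mathbb{E}^4$ orthogonal to $(1,1,1,1)$: $$U_3=\{\operatorname{proj}_{(1,1,1,1)^\perp}(v)\mid v\in M_4\}.$$ This subspace is identified isometrically with $\mathbb{E}^3$, and $\mathrm{Vol}$ denotes $3$-dimensional volume (Lebesgue measure). *)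

theory Defs
  imports "HOL-Analysis.Analysis"
begin

definition nonneg_orthant :: "(real ^ 'n) set" where
  "nonneg_orthant = {x. \<forall>i. 0 \<le> x $ i}"

definition M4 :: "(real ^ 4) set" where
  "M4 = {v - w | v w. v \<in> nonneg_orthant \<and> w \<in> nonneg_orthant \<and>
           (norm v)\<^sup>2 + (norm w + sqrt 2)\<^sup>2 \<le> 4}"

definition orth_proj :: "'a::euclidean_space set \<Rightarrow> 'a \<Rightarrow> 'a" where
  "orth_proj S x = (THE p. p \<in> S \<and> x - p \<in> S\<^sup>\<bottom>)"

lemma orth_proj_unique:
  assumes "subspace S" "p \<in> S" "x - p \<in> S\<^sup>\<bottom>"
  shows "orth_proj S x = p"
  unfolding orth_proj_def
proof (rule the_equality)
  show "p \<in> S \<and> x - p \<in> S\<^sup>\<bottom>" using assms by simp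
next
  fix q assume q: "q \<in> S \<and> x - q \<in> S\<^sup>\<bottom>"
  then have "q - p \<in> S" using assms by (simp add: subspace_diff)
  moreover have "(x - p) - (x - q) \<in> S\<^sup>\<bottom>"
    using subspace_diff[OF subspace_orthogonal_comp assms(3)] q by blast
  ultimately have "orthogonal (q - p) (q - p)"
    by (simp add: orthogonal_comp_def)
  then show "q = p" by (simp add: orthogonal_self)
qed

lemma orth_proj:
  assumes "subspace S"
  shows "orth_proj S x \<in> S" "x - orth_proj S x \<in> S\<^sup>\<bottom>"
proof -
  have "x \<in> S + S\<^sup>\<bottom>" using subspace_sum_orthogonal_comp[OF assms] by simp
  then obtain p q where "x = p + q" "p \<in> S" "q \<in> S\<^sup>\<bottom>" by (rule set_plus_elim)
  then show "orth_proj S x \<in> S" "x - orth_proj S x \<in> S\<^sup>\<bottom>"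
    using orth_proj_unique[OF assms, of p x] by auto
qed

definition ones_perp :: "(real ^ 4) set" where
  "ones_perp = {vec 1}\<^sup>\<bottom>"

definition U3 :: "(real ^ 4) set" where
  "U3 = orth_proj ones_perp ` M4"

text \<open>
  An isometric identification of Euclidean 3-space with the hyperplane \<^term>\<open>ones_perp\<close>.
  The 3-dimensional volume of a subset \<open>U\<close> of the hyperplane is the Lebesgue measure of
  \<open>f -` U\<close>, which does not depend on the choice of \<open>f\<close>.
\<close>
definition ones_perp_isometry :: "(real ^ 3 \<Rightarrow> real ^ 4) \<Rightarrow> bool" where
  "ones_perp_isometry f \<longleftrightarrow> linear f \<and> (\<forall>x. norm (f x) = norm x) \<and> range f = ones_perp"

lemma ones_perp_isometry_exists: "\<exists>f. ones_perp_isometry f"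
proof -
  have "ones_perp = {x. vec 1 \<bullet> x = 0}"
    by (simp add: ones_perp_def orthogonal_comp_def orthogonal_def)
  moreover have "(vec 1 :: real ^ 4) \<noteq> 0"
    by (simp add: vec_eq_iff)
  ultimately have "dim (UNIV :: (real ^ 3) set) = dim ones_perp"
    using dim_hyperplane[of "vec 1 :: real ^ 4"] by simp
  moreover have "subspace ones_perp"
    by (simp add: ones_perp_def subspace_orthogonal_comp)
  ultimately obtain f :: "real ^ 3 \<Rightarrow> real ^ 4"
    where "linear f" "f ` UNIV = ones_perp" "\<And>x. x \<in> UNIV \<Longrightarrow> norm (f x) = norm x"
    using isometry_subspaces[of "UNIV :: (real ^ 3) set" ones_perp] by (metis subspace_UNIV)
  then show ?thesis unfolding ones_perp_isometry_def by auto
qed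

end

(*
  Write s for p + (sqrt 2 / 4) (1,1,1,1), the barycentric coordinates (with sum sqrt 2) of a point p of the
  hyperplane with respect to the regular tetrahedron T of edge length 2 whose vertices are the projections of
  the vectors sqrt 2 e_i. Since |v|^2 + (|w| + sqrt 2)^2 bounds |v - w - sqrt 2 e|^2 for every unit vector e in
  the orthant, U3 lies in every ball of radius 2 around the projection of such a sqrt 2 e. Split U3 by the set N
  of indices with s_i < 0.
    N empty: all of T.
    N = {i}: the cone at the i-th vertex of T, cut with the ball of radius 2 around that vertex, minus T; its
      volume is given by Girard's theorem.
    N = {i, j}: up to a null set, the image of {sqrt 2 < r, |q| < pi/4, z^2 <= 4 - (1 + cos^2 q) r^2} under
      (r, q, z) |-> ((sqrt 2 r - 1) cos q, (r - sqrt 2) sin q, z); here q is the direction of the optimal w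
      and r = |w| + sqrt 2.
    |N| >= 3: empty.
  So Vol(U3) = 4 * sector - 3 * Vol(T) + 6 * edge. The decimals come from expanding (1 - a^4)^(-1/2) in the
  integral and integrating a^(2i) arctan a in closed form.
*)
theory Submission
  imports Defs
begin

subsection \<open>Volumes in elliptic cylinder coordinates\<close>

text \<open>Membership of p asks for the least value of |v|^2 + (|w| + sqrt 2)^2 over all lifts p +
  t (1,1,1,1) = v - w. This minimum is never computed: sufficiency is shown by an explicit pair v,
  w, and necessity by a single ball. That ball loses nothing, because for e = w/|w| and v, w of
  disjoint support the inequality behind the balls is an equality. The explicit pairs come from
  stationarity in t, which reads sum v_i = (|w| + sqrt 2) sum e_i. For e a coordinate axis it gives
  t = sqrt 2 / 4, the shift that defines s. For e = (0, 0, cos q - sin q, cos q + sin q)/sqrt 2 and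
  r = |w| + sqrt 2 it gives v_1 + v_2 = sqrt 2 r cos q, while w_3 + w_4 = sqrt 2 (r - sqrt 2) cos q;
  hence t = (cos q)/2, and solving for p produces the edge map. Its levels r = const are ellipses,
  which is why cylinder coordinates for the balls and the edge coordinates can share one change of
  variables.\<close>

definition vec3 :: "real \<times> real \<times> real \<Rightarrow> real ^ 3" where
  "vec3 p = vector [fst (snd p), fst p, snd (snd p)]"

lemma vec3_nth [simp]: "vec3 (q, r, z) $ 1 = r" "vec3 (q, r, z) $ 2 = q" "vec3 (q, r, z) $ 3 = z"
  by (simp_all add: vec3_def)

lemma mem_box_3: "x \<in> box l u \<longleftrightarrow> (l::real^3) $ 1 < x $ 1 \<and> x $ 1 < u $ 1 \<and> l $ 2 < x $ 2 \<and> x $ 2 < u $ 2 \<and> l $ 3 < x $ 3 \<and> x $ 3 < u $ 3"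
  by (auto simp: mem_box_cart forall_3)

lemma continuous_vec3: "continuous_on UNIV vec3"
proof -
  have "continuous_on UNIV (\<lambda>p. vec3 p $ i)" for i
    using exhaust_3[of i] by (elim disjE) (simp_all add: vec3_def continuous_on_fst continuous_on_snd continuous_on_id)
  then have "continuous_on UNIV (\<lambda>p. \<chi> i. vec3 p $ i)"
    by (rule continuous_on_vec_lambda)
  then show ?thesis by (simp add: vec_nth_inverse)
qed

lemma measurable_vec3 [measurable]: "vec3 \<in> borel_measurable borel"
  using continuous_vec3 by (rule borel_measurable_continuous_onI)

lemma distr_vec3: "distr lborel borel vec3 = lborel"
proof (rule lborel_eqI[symmetric])
  fix l u :: "real ^ 3"
  assume le: "\<And>b. b \<in> Basis \<Longrightarrow> l \<bullet> b \<le> u \<bullet> b"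
  have le': "l $ i \<le> u $ i" for i
    using le[of "axis i 1"] by (simp add: inner_axis axis_in_Basis_iff)
  have "vec3 -` box l u = {l$2<..<u$2} \<times> {l$1<..<u$1} \<times> {l$3<..<u$3}"
    by (auto simp: mem_box_3)
  then have "emeasure (distr lborel borel vec3) (box l u) =
      emeasure (lborel \<Otimes>\<^sub>M (lborel \<Otimes>\<^sub>M lborel)) ({l$2<..<u$2} \<times> {l$1<..<u$1} \<times> {l$3<..<u$3})"
    by (subst emeasure_distr) (auto simp: lborel_prod)
  also have "\<dots> = ennreal ((u$2 - l$2) * ((u$1 - l$1) * (u$3 - l$3)))"
  proof -
    have P: "sigma_finite_measure (lborel \<Otimes>\<^sub>M lborel :: (real \<times> real) measure)"
      unfolding lborel_prod by (rule sigma_finite_lborel)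
    have "emeasure (lborel \<Otimes>\<^sub>M (lborel \<Otimes>\<^sub>M lborel)) ({l$2<..<u$2} \<times> {l$1<..<u$1} \<times> {l$3<..<u$3})
        = emeasure lborel {l$2<..<u$2} * emeasure (lborel \<Otimes>\<^sub>M lborel) ({l$1<..<u$1} \<times> {l$3<..<u$3})"
      by (rule sigma_finite_measure.emeasure_pair_measure_Times[OF P]) (auto intro!: pair_measureI)
    also have "\<dots> = emeasure lborel {l$2<..<u$2} * (emeasure lborel {l$1<..<u$1} * emeasure lborel {l$3<..<u$3})"
      by (subst lborel.emeasure_pair_measure_Times) (rule sets_lborel[THEN equalityD2, THEN subsetD], simp, rule sets_lborel[THEN equalityD2, THEN subsetD], simp, rule refl)
    also have "\<dots> = ennreal ((u$2 - l$2) * ((u$1 - l$1) * (u$3 - l$3)))"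
      using le'[of 1] le'[of 2] le'[of 3] by (simp add: ennreal_mult)
    finally show ?thesis .
  qed
  also have "(u$2 - l$2) * ((u$1 - l$1) * (u$3 - l$3)) = (\<Prod>i\<in>UNIV. (u - l) $ i)"
    unfolding UNIV_3 by simp
  also have "\<dots> = (\<Prod>b\<in>Basis. (u - l) \<bullet> b)"
  proof -
    have "(Basis :: (real ^ 3) set) = (\<lambda>i. axis i 1) ` UNIV"
      by (auto simp: Basis_vec_def)
    then have "(\<Prod>b\<in>Basis. (u - l) \<bullet> b) = (\<Prod>b\<in>range (\<lambda>i. axis i 1). (u - l) \<bullet> b)"
      by simp
    also have "\<dots> = (\<Prod>i\<in>UNIV. (u - l) $ i)"
      by (subst prod.reindex) (auto simp: inj_on_def axis_eq_axis inner_axis)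
    finally show ?thesis by (rule sym)
  qed
  finally show "emeasure (distr lborel borel vec3) (box l u) = (\<Prod>b\<in>Basis. (u - l) \<bullet> b)" .
qed simp

text \<open>\<open>vec3\<close> exchanges the first two coordinates so that the angle becomes the
  outermost variable: the range of r depends on q, and the range of z on both.\<close>

lemma nn_integral_vec3:
  assumes [measurable]: "h \<in> borel_measurable borel"
  shows "(\<integral>\<^sup>+ y. h y \<partial>lborel) = (\<integral>\<^sup>+ q. \<integral>\<^sup>+ r. \<integral>\<^sup>+ z. h (vec3 (q, r, z)) \<partial>lborel \<partial>lborel \<partial>lborel)"
proof -
  have m: "(\<lambda>p. h (vec3 (q, p))) \<in> borel_measurable (lborel \<Otimes>\<^sub>M lborel)" for q
    unfolding lborel_prod by measurable
  have m': "(\<lambda>p. h (vec3 p)) \<in> borel_measurable (lborel \<Otimes>\<^sub>M (lborel \<Otimes>\<^sub>M lborel))"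
    unfolding lborel_prod by measurable
  have "(\<integral>\<^sup>+ y. h y \<partial>lborel) = (\<integral>\<^sup>+ y. h y \<partial>(distr lborel borel vec3))"
    by (simp only: distr_vec3)
  also have "\<dots> = (\<integral>\<^sup>+ p. h (vec3 p) \<partial>lborel)"
    by (rule nn_integral_distr) simp_all
  also have "\<dots> = (\<integral>\<^sup>+ p. h (vec3 p) \<partial>(lborel \<Otimes>\<^sub>M (lborel \<Otimes>\<^sub>M lborel)))"
    by (simp only: lborel_prod)
  also have "\<dots> = (\<integral>\<^sup>+ q. \<integral>\<^sup>+ p. h (vec3 (q, p)) \<partial>(lborel \<Otimes>\<^sub>M lborel) \<partial>lborel)"
  proof (rule sigma_finite_measure.nn_integral_fst[OF _ m', symmetric])
    show "sigma_finite_measure (lborel \<Otimes>\<^sub>M lborel :: (real \<times> real) measure)"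
      unfolding lborel_prod by (rule sigma_finite_lborel)
  qed
  also have "\<dots> = (\<integral>\<^sup>+ q. \<integral>\<^sup>+ r. \<integral>\<^sup>+ z. h (vec3 (q, r, z)) \<partial>lborel \<partial>lborel \<partial>lborel)"
    using lborel.nn_integral_fst[OF m] by (intro nn_integral_cong) simp
  finally show ?thesis .
qed

text \<open>The parameters \<open>(1, 0, 1, 0)\<close> give cylinder coordinates, used for lunes of a ball, and
  \<open>(sqrt 2, 1, 1, sqrt 2)\<close> the edge regions. In both cases the height condition is
  \<open>z\<^sup>2 \<le> 4 - (a\<^sup>2 (cos q)\<^sup>2 + c\<^sup>2 (sin q)\<^sup>2) r\<^sup>2\<close>.\<close>

definition ell_cyl :: "real \<Rightarrow> real \<Rightarrow> real \<Rightarrow> real \<Rightarrow> real ^ 3 \<Rightarrow> real ^ 3" where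
  "ell_cyl a b c d y = vector [(a * y$1 - b) * cos (y$2), (c * y$1 - d) * sin (y$2), y$3]"

definition ell_cyl_deriv :: "real \<Rightarrow> real \<Rightarrow> real \<Rightarrow> real \<Rightarrow> real ^ 3 \<Rightarrow> real ^ 3 \<Rightarrow> real ^ 3" where
  "ell_cyl_deriv a b c d y h = vector
     [a * cos (y$2) * h$1 - (a * y$1 - b) * sin (y$2) * h$2,
      c * sin (y$2) * h$1 + (c * y$1 - d) * cos (y$2) * h$2, h$3]"

definition ell_jac :: "real \<Rightarrow> real \<Rightarrow> real \<Rightarrow> real \<Rightarrow> real \<Rightarrow> real \<Rightarrow> real" where
  "ell_jac a b c d r q = a * (c * r - d) * (cos q)\<^sup>2 + c * (a * r - b) * (sin q)\<^sup>2"

lemma has_derivative_ell_cyl: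
  "(ell_cyl a b c d has_derivative ell_cyl_deriv a b c d y) (at y within S)"
proof -
  have nth: "((\<lambda>y::real^3. y $ i) has_derivative (\<lambda>h. h $ i)) (at y within S)" for i
    by (rule bounded_linear.has_derivative[OF bounded_linear_vec_nth has_derivative_ident])
  have "((\<lambda>y. (a * y$1 - b) * cos (y$2)) has_derivative
      (\<lambda>h. a * cos (y$2) * h$1 - (a * y$1 - b) * sin (y$2) * h$2)) (at y within S)"
    by (rule derivative_eq_intros nth refl)+ (simp add: algebra_simps)
  moreover have "((\<lambda>y. (c * y$1 - d) * sin (y$2)) has_derivative
      (\<lambda>h. c * sin (y$2) * h$1 + (c * y$1 - d) * cos (y$2) * h$2)) (at y within S)"
    by (rule derivative_eq_intros nth refl)+ (simp add: algebra_simps)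
  ultimately have "((\<lambda>y. ell_cyl a b c d y $ i) has_derivative (\<lambda>h. ell_cyl_deriv a b c d y h $ i)) (at y within S)" for i
    using exhaust_3[of i] nth[of 3] by (elim disjE) (simp_all only: ell_cyl_def ell_cyl_deriv_def vector_3)
  then show ?thesis
    unfolding has_derivative_componentwise_within[of "ell_cyl a b c d"]
    by (auto simp: Basis_vec_def inner_axis)
qed

lemma det_ell_cyl_deriv: "det (matrix (ell_cyl_deriv a b c d y)) = ell_jac a b c d (y$1) (y$2)"
  by (simp add: det_3 matrix_def ell_cyl_deriv_def axis_def ell_jac_def power2_eq_square algebra_simps)

text \<open>The levels of r are nested ellipses. Keeping the image point while increasing r would
  strictly decrease the cosine without increasing the absolute value of the sine, against cos^2 +
  sin^2 = 1.\<close>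

lemma inj_on_ell_cyl:
  assumes "0 < a" "0 < c" "0 \<le> a * r0 - b" "0 \<le> c * r0 - d" "q1 \<le> pi / 2"
  shows "inj_on (ell_cyl a b c d) {y. r0 < y$1 \<and> \<bar>y$2\<bar> < q1}"
proof (rule inj_onI, clarify)
  fix y y' :: "real ^ 3"
  assume r: "r0 < y$1" "r0 < y'$1" and q: "\<bar>y$2\<bar> < q1" "\<bar>y'$2\<bar> < q1"
    and eq: "ell_cyl a b c d y = ell_cyl a b c d y'"
  have pos: "0 < a * y$1 - b" "0 < c * y$1 - d" "0 < a * y'$1 - b" "0 < c * y'$1 - d"
    using assms r mult_strict_left_mono[of r0 "y$1" a] mult_strict_left_mono[of r0 "y$1" c]
      mult_strict_left_mono[of r0 "y'$1" a] mult_strict_left_mono[of r0 "y'$1" c] by linarith+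
  have cpos: "0 < cos (y$2)" "0 < cos (y'$2)"
    using q assms(5) by (auto intro!: cos_gt_zero_pi)
  have e: "(a * y$1 - b) * cos (y$2) = (a * y'$1 - b) * cos (y'$2)"
    "(c * y$1 - d) * sin (y$2) = (c * y'$1 - d) * sin (y'$2)" "y$3 = y'$3"
    using arg_cong[OF eq, of "\<lambda>z. z$1"] arg_cong[OF eq, of "\<lambda>z. z$2"] arg_cong[OF eq, of "\<lambda>z. z$3"]
    by (simp_all add: ell_cyl_def)
  have no: False if le: "u < v" and p: "0 < a * u - b" "0 < c * u - d" "0 < cos s" "0 < cos t"
    and e1: "(a * u - b) * cos s = (a * v - b) * cos t"
    and e2: "(c * u - d) * sin s = (c * v - d) * sin t" for u v s t
  proof -
    have l: "a * u - b < a * v - b" "c * u - d < c * v - d"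
      using le assms(1,2) by auto
    have "cos t < cos s"
    proof (rule ccontr)
      assume "\<not> cos t < cos s"
      then have "(a * u - b) * cos s < (a * v - b) * cos t"
        using l p by (intro mult_less_le_imp_less) auto
      then show False using e1 by simp
    qed
    moreover have "\<bar>sin t\<bar> \<le> \<bar>sin s\<bar>"
    proof (rule ccontr)
      assume n: "\<not> \<bar>sin t\<bar> \<le> \<bar>sin s\<bar>"
      then have "(c * u - d) * \<bar>sin s\<bar> < (c * v - d) * \<bar>sin t\<bar>"
        using l p by (intro mult_strict_mono) auto
      moreover have "(c * u - d) * \<bar>sin s\<bar> = (c * v - d) * \<bar>sin t\<bar>"
        using arg_cong[OF e2, of abs] p(2) l(2) by (simp add: abs_mult)
      ultimately show False by simp
    qed
    moreover have "(cos t)\<^sup>2 < (cos s)\<^sup>2"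
      using calculation(1) p(4) by (intro power_strict_mono) auto
    moreover have "(sin t)\<^sup>2 \<le> (sin s)\<^sup>2"
      using calculation(2) by (simp add: abs_le_square_iff)
    ultimately show False
      using sin_cos_squared_add[of s] sin_cos_squared_add[of t] by linarith
  qed
  have r_eq: "y$1 = y'$1"
    using no[OF _ pos(1,2) cpos e(1,2)] no[OF _ pos(3,4) cpos(2,1) e(1,2)[symmetric]]
    by (cases "y$1" "y'$1" rule: linorder_cases) auto
  have sin_eq: "sin (y$2) = sin (y'$2)"
    using e(2) pos(4) r_eq by simp
  have "y$2 = y'$2"
    by (rule sin_inj_pi[OF _ _ _ _ sin_eq]) (use q assms(5) in linarith)+
  then show "y = y'"
    using r_eq e(3) by (subst vec_eq_iff, subst forall_3) blast
qed

lemma borel_measurable_nth3 [measurable]: "(\<lambda>y::real^3. y $ i) \<in> borel_measurable borel"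
  by (intro borel_measurable_continuous_onI continuous_intros)

text \<open>Change of variables followed by iterated integration over z, r and q. The z-section is
  an interval of length 2 sqrt (4 - k r^2), and r ends at 2 / sqrt k, where that length
  vanishes.\<close>

lemma measure_ell_cyl:
  fixes a b c d r0 q1 V :: real and I :: "real \<Rightarrow> real"
  defines "k \<equiv> \<lambda>q. a\<^sup>2 * (cos q)\<^sup>2 + c\<^sup>2 * (sin q)\<^sup>2"
  assumes a: "0 < a" and c: "0 < c" and b: "0 \<le> a * r0 - b" and d: "0 \<le> c * r0 - d"
    and r0: "0 \<le> r0" and q1: "q1 \<le> pi / 2"
    and I: "\<And>q. \<bar>q\<bar> < q1 \<Longrightarrow>
      ((\<lambda>r. 2 * sqrt (4 - k q * r\<^sup>2) * ell_jac a b c d r q) has_integral I q) {r0..2 / sqrt (k q)}"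
    and V: "(I has_integral V) {-q1..q1}"
  defines "S \<equiv> {y. r0 < y$1 \<and> \<bar>y$2\<bar> < q1 \<and> (y$3)\<^sup>2 \<le> 4 - k (y$2) * (y$1)\<^sup>2}"
  shows "ell_cyl a b c d ` S \<in> lmeasurable \<and> measure lebesgue (ell_cyl a b c d ` S) = V"
proof -
  have [measurable]: "k \<in> borel_measurable borel"
    unfolding k_def by measurable
  have [measurable]: "(\<lambda>y::real^3. ell_jac a b c d (y$1) (y$2)) \<in> borel_measurable borel"
    unfolding ell_jac_def by measurable
  have S [measurable]: "S \<in> sets borel"
    unfolding S_def by measurable
  have kpos: "0 < k q" for q
  proof -
    have "0 < (sin q)\<^sup>2" if "cos q = 0"
      using that sin_zero_norm_cos_one[of q] by fastforce
    then show ?thesis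
      unfolding k_def using a c
      by (cases "cos q = 0") (auto intro!: add_pos_nonneg mult_pos_pos)
  qed
  have k_iff: "0 \<le> 4 - k q * r\<^sup>2 \<longleftrightarrow> r \<le> 2 / sqrt (k q)" if "0 \<le> r" for q r
  proof -
    have "0 \<le> 4 - k q * r\<^sup>2 \<longleftrightarrow> (sqrt (k q) * r)\<^sup>2 \<le> 2\<^sup>2"
      using kpos[of q] by (simp add: power_mult_distrib)
    also have "\<dots> \<longleftrightarrow> sqrt (k q) * r \<le> 2"
      using that kpos[of q] by (intro power_mono_iff) auto
    also have "\<dots> \<longleftrightarrow> r \<le> 2 / sqrt (k q)"
      using kpos[of q] by (simp add: field_simps)
    finally show ?thesis .
  qed
  have jac: "0 \<le> ell_jac a b c d r q" if "r0 \<le> r" for r q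
  proof -
    have "a * r0 \<le> a * r" "c * r0 \<le> c * r"
      using that a c by auto
    then have "0 \<le> a * r - b" "0 \<le> c * r - d"
      using b d by linarith+
    then show ?thesis
      unfolding ell_jac_def using a c by (intro add_nonneg_nonneg mult_nonneg_nonneg) auto
  qed
  have I0: "0 \<le> I q" if "\<bar>q\<bar> < q1" for q
    using I[OF that] by (rule has_integral_nonneg) (use r0 k_iff jac in auto)

  \<comment> \<open>Injectivity requires the strict inequalities in \<open>S\<close>, whereas the
    given integrals live on closed intervals. The indicators therefore exclude the endpoints
    \<open>r0\<close> and \<open>-q1\<close>, \<open>q1\<close>, which are discarded later as null
    sets.\<close>
  have inner: "(\<integral>\<^sup>+ z. indicator S (vec3 (q, r, z)) * ennreal (ell_jac a b c d r q) \<partial>lborel)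
      = (if \<bar>q\<bar> < q1 then indicator ({r0..2 / sqrt (k q)} - {r0}) r *
          ennreal (2 * sqrt (4 - k q * r\<^sup>2) * ell_jac a b c d r q) else 0)" for q r
  proof (cases "\<bar>q\<bar> < q1 \<and> r0 < r \<and> r \<le> 2 / sqrt (k q)")
    case True
    define h where "h = sqrt (4 - k q * r\<^sup>2)"
    have h: "0 \<le> h" "h\<^sup>2 = 4 - k q * r\<^sup>2"
      using True k_iff[of r q] r0 by (auto simp: h_def)
    have "z\<^sup>2 \<le> 4 - k q * r\<^sup>2 \<longleftrightarrow> z \<in> {-h..h}" for z
      unfolding h(2)[symmetric] using h(1) by (auto simp: abs_le_square_iff[symmetric])
    then have "indicator S (vec3 (q, r, z)) = (indicator {-h..h} z :: ennreal)" for z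
      using True by (auto simp: S_def indicator_def)
    then have "(\<integral>\<^sup>+ z. indicator S (vec3 (q, r, z)) * ennreal (ell_jac a b c d r q) \<partial>lborel)
        = ennreal (2 * h) * ennreal (ell_jac a b c d r q)"
      using h(1) by (simp add: nn_integral_multc)
    then show ?thesis
      using True h(1) jac[of r q] by (simp add: h_def ennreal_mult')
  next
    case False
    have "vec3 (q, r, z) \<notin> S" for z
    proof
      assume "vec3 (q, r, z) \<in> S"
      then have *: "r0 < r" "\<bar>q\<bar> < q1" "z\<^sup>2 \<le> 4 - k q * r\<^sup>2"
        by (simp_all add: S_def)
      have "0 \<le> 4 - k q * r\<^sup>2"
        using *(3) by (rule order_trans[OF zero_le_power2])
      then show False
        using * False k_iff[of r q] r0 by auto
    qed
    then show ?thesis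
      using False by auto
  qed
  have middle: "(\<integral>\<^sup>+ r. \<integral>\<^sup>+ z. indicator S (vec3 (q, r, z)) * ennreal (ell_jac a b c d r q) \<partial>lborel \<partial>lborel)
      = indicator ({-q1..q1} - {-q1, q1}) q * ennreal (I q)" for q
  proof (cases "\<bar>q\<bar> < q1")
    case True
    have "(\<integral>\<^sup>+ r. \<integral>\<^sup>+ z. indicator S (vec3 (q, r, z)) * ennreal (ell_jac a b c d r q) \<partial>lborel \<partial>lborel)
        = (\<integral>\<^sup>+ r. ennreal (indicator {r0..2 / sqrt (k q)} r *
          (2 * sqrt (4 - k q * r\<^sup>2) * ell_jac a b c d r q)) \<partial>lborel)"
      unfolding inner using True
      by (intro nn_integral_cong_AE AE_I[where N = "{r0}"]) (auto simp: indicator_def)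
    also have "\<dots> = ennreal (I q)"
      by (rule nn_integral_has_integral_lebesgue[OF _ I[OF True]]) (use r0 k_iff jac in auto)
    finally show ?thesis
      using True by (auto simp: indicator_def)
  next
    case False
    then show ?thesis
      unfolding inner by (auto simp: indicator_def)
  qed
  have "(\<integral>\<^sup>+ y. indicator S y * ennreal (ell_jac a b c d (y$1) (y$2)) \<partial>lborel)
      = (\<integral>\<^sup>+ q. indicator ({-q1..q1} - {-q1, q1}) q * ennreal (I q) \<partial>lborel)"
    by (subst nn_integral_vec3) (simp_all add: middle)
  also have "\<dots> = (\<integral>\<^sup>+ q. ennreal (indicator {-q1..q1} q * (if \<bar>q\<bar> < q1 then I q else 0)) \<partial>lborel)"
    by (intro nn_integral_cong) (auto simp: indicator_def)
  also have "\<dots> = ennreal V"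
  proof (rule nn_integral_has_integral_lebesgue)
    show "((\<lambda>q. if \<bar>q\<bar> < q1 then I q else 0) has_integral V) {-q1..q1}"
      by (rule has_integral_spike_finite[where S = "{-q1, q1}", OF _ _ V]) auto
  qed (use I0 in auto)
  also have "(\<integral>\<^sup>+ y. indicator S y * ennreal (ell_jac a b c d (y$1) (y$2)) \<partial>lborel)
      = (\<integral>\<^sup>+ y. ennreal (indicator S y * ell_jac a b c d (y$1) (y$2)) \<partial>lborel)"
    by (intro nn_integral_cong) (simp split: split_indicator)
  finally have "(\<integral>\<^sup>+ y. ennreal (indicator S y * ell_jac a b c d (y$1) (y$2)) \<partial>lborel) = ennreal V" .
  moreover have "0 \<le> V"
  proof (rule has_integral_nonneg)
    show "((\<lambda>q. if \<bar>q\<bar> < q1 then I q else 0) has_integral V) {-q1..q1}"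
      by (rule has_integral_spike_finite[where S = "{-q1, q1}", OF _ _ V]) auto
  qed (use I0 in auto)
  ultimately have *: "((\<lambda>y. indicator S y * ell_jac a b c d (y$1) (y$2)) has_integral V) UNIV"
    using jac by (intro nn_integral_has_integral) (auto simp: indicator_def S_def)
  have "((\<lambda>y. ell_jac a b c d (y$1) (y$2)) has_integral V) S"
  proof -
    have "(\<lambda>y. indicator S y * ell_jac a b c d (y$1) (y$2)) =
        (\<lambda>y. if y \<in> S then ell_jac a b c d (y$1) (y$2) else 0)"
      by (auto simp: fun_eq_iff)
    with *[unfolded this] show ?thesis
      by (simp only: has_integral_restrict_UNIV)
  qed
  then have "((\<lambda>y. \<bar>det (matrix (ell_cyl_deriv a b c d y))\<bar>) has_integral V) S"
    by (rule has_integral_eq[rotated]) (use jac in \<open>auto simp: det_ell_cyl_deriv S_def\<close>)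
  moreover have "inj_on (ell_cyl a b c d) S"
    by (rule inj_on_subset[OF inj_on_ell_cyl[OF a c b d q1]]) (auto simp: S_def)
  ultimately show ?thesis
    using has_measure_differentiable_image[of S "ell_cyl a b c d" "ell_cyl_deriv a b c d" V]
      has_derivative_ell_cyl by simp
qed

subsection \<open>The integrals for the edge regions\<close>

lemma lune_has_integral:
  "((\<lambda>r. 2 * sqrt (4 - r\<^sup>2) * r) has_integral 16 / 3) {0..2::real}"
proof -
  define F :: "real \<Rightarrow> real" where "F = (\<lambda>r. - (2 / 3) * ((4 - r\<^sup>2) * sqrt (4 - r\<^sup>2)))"
  have "((\<lambda>r. 2 * sqrt (4 - r\<^sup>2) * r) has_integral F 2 - F 0) {0..2::real}"
  proof (rule fundamental_theorem_of_calculus_interior)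
    show "continuous_on {0..2} F"
      unfolding F_def by (intro continuous_intros)
    fix r :: real
    assume "r \<in> {0<..<2}"
    then have "r\<^sup>2 < 2\<^sup>2"
      by (intro power_strict_mono) auto
    then have pos: "0 < 4 - r\<^sup>2" by simp
    have "(F has_real_derivative
        - (2 / 3) * ((- (2 * r)) * sqrt (4 - r\<^sup>2) + (4 - r\<^sup>2) * (- (2 * r) / (2 * sqrt (4 - r\<^sup>2))))) (at r)"
      unfolding F_def using pos
      by (auto intro!: derivative_eq_intros simp: field_simps)
    also have "(4 - r\<^sup>2) * (- (2 * r) / (2 * sqrt (4 - r\<^sup>2))) = - r * sqrt (4 - r\<^sup>2)"
      using pos by (simp add: field_simps flip: power2_eq_square)
    finally show "(F has_vector_derivative 2 * sqrt (4 - r\<^sup>2) * r) (at r)"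
      unfolding has_real_derivative_iff_has_vector_derivative by (simp add: algebra_simps)
  qed simp
  then show ?thesis
    by (simp add: F_def)
qed

text \<open>Here \<open>k\<close> stands for 1 + (cos q)^2 and \<open>s\<close> for |sin q|; the
  factor \<open>sqrt 2 * r - k\<close> is the Jacobian of the edge map.\<close>

lemma edge_inner_has_integral:
  fixes k s :: real
  assumes k: "1 \<le> k" "k \<le> 2" and s: "0 \<le> s" "s\<^sup>2 = 2 - k"
  shows "((\<lambda>r. 2 * sqrt (4 - k * r\<^sup>2) * (sqrt 2 * r - k)) has_integral
    8 / 3 * s ^ 3 / k + 2 * k * s - 4 * sqrt k * arctan (s / sqrt k)) {sqrt 2..2 / sqrt k}"
proof -
  \<comment> \<open>The part of the integrand with \<open>sqrt 2 * r\<close> integrates to a power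
    of 4 - k r^2; the part with \<open>- k\<close> is an area under an ellipse and gives the product
    and the arcsine. The single summands are not differentiable at the upper end, so only interior
    differentiability is used.\<close>
  define F :: "real \<Rightarrow> real" where "F = (\<lambda>r. - (2 * sqrt 2 / (3 * k)) * ((4 - k * r\<^sup>2) * sqrt (4 - k * r\<^sup>2))
     - k * (r * sqrt (4 - k * r\<^sup>2)) - 4 * sqrt k * arcsin (sqrt k * r / 2))"
  have c: "0 < sqrt k" "(sqrt k)\<^sup>2 = k" "sqrt k * sqrt k = k"
    using k by auto
  have le: "sqrt 2 \<le> 2 / sqrt k"
  proof -
    have "sqrt 2 * sqrt k \<le> sqrt 2 * sqrt 2"
      using k by (intro mult_left_mono) auto
    then show ?thesis using c by (simp add: field_simps)
  qed
  have "((\<lambda>r. 2 * sqrt (4 - k * r\<^sup>2) * (sqrt 2 * r - k)) has_integral F (2 / sqrt k) - F (sqrt 2)) {sqrt 2..2 / sqrt k}"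
  proof (rule fundamental_theorem_of_calculus_interior[OF le])
    have arc: "continuous_on {sqrt 2..2 / sqrt k} (\<lambda>r. arcsin (sqrt k * r / 2))"
    proof (rule continuous_on_arcsin)
      show "continuous_on {sqrt 2..2 / sqrt k} (\<lambda>r. sqrt k * r / 2)"
        by (intro continuous_intros) auto
      have "0 \<le> sqrt k * r / 2 \<and> sqrt k * r / 2 \<le> 1" if "r \<in> {sqrt 2..2 / sqrt k}" for r
      proof -
        have "0 \<le> r" using that order_trans[of 0 "sqrt 2" r] by simp
        then show ?thesis
          using that c by (auto simp: field_simps)
      qed
      then show "\<forall>r\<in>{sqrt 2..2 / sqrt k}. - 1 \<le> sqrt k * r / 2 \<and> sqrt k * r / 2 \<le> 1"
        by force
    qed
    show "continuous_on {sqrt 2..2 / sqrt k} F"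
      unfolding F_def
      by (rule continuous_on_diff[OF continuous_on_diff continuous_on_mult[OF continuous_on_const arc]])
        (intro continuous_intros)+
    fix r :: real
    assume r: "r \<in> {sqrt 2<..<2 / sqrt k}"
    have r0: "0 < r" using r less_trans[of 0 "sqrt 2" r] by simp
    then have lt: "0 < sqrt k * r" "sqrt k * r < 2"
      using r c by (auto simp: field_simps)
    then have "(sqrt k * r)\<^sup>2 < 2\<^sup>2"
      by (intro power_strict_mono) auto
    then have pos: "0 < 4 - k * r\<^sup>2"
      by (simp add: power_mult_distrib c(2))
    define w where "w = sqrt (4 - k * r\<^sup>2)"
    have w: "0 < w" "w\<^sup>2 = 4 - k * r\<^sup>2"
      using pos by (auto simp: w_def)
    have 0: "((\<lambda>r. 4 - k * r\<^sup>2) has_real_derivative - (2 * k * r)) (at r)"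
      by (auto intro!: derivative_eq_intros)
    have 1: "((\<lambda>r. sqrt (4 - k * r\<^sup>2)) has_real_derivative - (k * r) / w) (at r)"
      unfolding w_def using pos by (auto intro!: derivative_eq_intros simp: field_simps)
    have "sqrt (1 - (sqrt k * r / 2)\<^sup>2) = w / 2"
    proof (rule real_sqrt_unique)
      show "(w / 2)\<^sup>2 = 1 - (sqrt k * r / 2)\<^sup>2"
        by (simp add: power_divide power_mult_distrib c(2) w(2) diff_divide_distrib)
    qed (use w in simp)
    then have 2: "((\<lambda>r. arcsin (sqrt k * r / 2)) has_real_derivative sqrt k / w) (at r)"
      using lt w(1) by (auto intro!: derivative_eq_intros simp: field_simps)
    have "(F has_real_derivative - (2 * sqrt 2 / (3 * k)) * ((- (2 * k * r)) * w + w\<^sup>2 * (- (k * r) / w))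
        - k * (w + r * (- (k * r) / w)) - 4 * sqrt k * (sqrt k / w)) (at r)"
      unfolding F_def
      by (rule DERIV_cong[OF DERIV_diff[OF DERIV_diff[OF DERIV_cmult[OF DERIV_mult[OF 0 1]]
              DERIV_cmult[OF DERIV_mult[OF DERIV_ident 1]]] DERIV_cmult[OF 2]]])
        (simp add: w(2) w_def[symmetric] algebra_simps)
    also have "- (2 * sqrt 2 / (3 * k)) * ((- (2 * k * r)) * w + w\<^sup>2 * (- (k * r) / w))
        - k * (w + r * (- (k * r) / w)) - 4 * sqrt k * (sqrt k / w) = 2 * w * (sqrt 2 * r - k)"
    proof -
      have e1: "w\<^sup>2 * (- (k * r) / w) = - (k * r) * w"
        using w(1) by (simp add: power2_eq_square)
      have e2: "k * (w + r * (- (k * r) / w)) + 4 * sqrt k * (sqrt k / w) = 2 * k * w"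
      proof -
        have "k * (w + r * (- (k * r) / w)) + 4 * sqrt k * (sqrt k / w) = k * (w\<^sup>2 + (4 - k * r\<^sup>2)) / w"
          using w(1) c(3) by (simp add: field_simps power2_eq_square)
        also have "\<dots> = 2 * k * w"
          unfolding w(2)[symmetric] using w(1) by (simp add: power2_eq_square)
        finally show ?thesis .
      qed
      have "- (2 * sqrt 2 / (3 * k)) * ((- (2 * k * r)) * w + - (k * r) * w) = 2 * w * (sqrt 2 * r)"
        using k by (simp add: field_simps)
      with e1 e2 show ?thesis by (simp add: algebra_simps)
    qed
    finally show "(F has_vector_derivative 2 * sqrt (4 - k * r\<^sup>2) * (sqrt 2 * r - k)) (at r)"
      unfolding has_real_derivative_iff_has_vector_derivative w_def .
  qed
  moreover have "F (2 / sqrt k) = - (4 * sqrt k * (pi / 2))"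
  proof -
    have "4 - k * (2 / sqrt k)\<^sup>2 = 0"
      using k by (simp add: power_divide)
    then show ?thesis
      using c unfolding F_def by simp
  qed
  moreover have "F (sqrt 2) = - (8 / 3 * s ^ 3 / k) - 2 * k * s - 4 * sqrt k * (pi / 2 - arctan (s / sqrt k))"
  proof -
    have "4 - k * (sqrt 2)\<^sup>2 = (sqrt 2 * s)\<^sup>2"
      using s by (simp add: power_mult_distrib)
    then have 1: "4 - k * (sqrt 2)\<^sup>2 = 2 * s\<^sup>2" "sqrt (4 - k * (sqrt 2)\<^sup>2) = sqrt 2 * s"
      using s(1) by (simp_all add: power_mult_distrib real_sqrt_mult)
    \<comment> \<open>The arcsine at the lower end is rewritten as an arctangent of
      \<open>s / sqrt k\<close>, the quantity that becomes the variable of the outer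
      integral.\<close>
    have "cos (arctan (s / sqrt k)) = sqrt k * sqrt 2 / 2"
    proof -
      have "1 + (s / sqrt k)\<^sup>2 = 2 / k"
        using k s by (simp add: power_divide field_simps)
      then show ?thesis
        using c by (simp add: cos_arctan real_sqrt_divide field_simps)
    qed
    then have eq: "sin (pi / 2 - arctan (s / sqrt k)) = sqrt k * sqrt 2 / 2"
      by (simp add: sin_diff)
    have "0 \<le> arctan (s / sqrt k)" "arctan (s / sqrt k) < pi / 2"
      using s(1) c(1) arctan_ubound[of "s / sqrt k"] by auto
    then have 2: "arcsin (sqrt k * sqrt 2 / 2) = pi / 2 - arctan (s / sqrt k)"
      using arcsin_sin[of "pi / 2 - arctan (s / sqrt k)"] unfolding eq by simp
    show ?thesis
      unfolding F_def 1(2) unfolding 1(1) 2 using k by (simp add: field_simps power3_eq_cube power2_eq_square)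
  qed
  ultimately show ?thesis
    by (simp add: algebra_simps)
qed

text \<open>The left side is the dihedral angle arccos (1/3) of a regular tetrahedron, which
  Girard's theorem produces; the right side is the form in which it enters the volume
  formula.\<close>

lemma arctan_inverse_sqrt_2: "2 * arctan (1 / sqrt 2) = pi / 2 - arctan (1 / sqrt 8)"
proof -
  have "2 * arctan (1 / sqrt 2) = arctan (2 * (1 / sqrt 2) / (1 - (1 / sqrt 2)\<^sup>2))"
    by (rule arctan_double) simp
  also have "2 * (1 / sqrt 2) / (1 - (1 / sqrt 2)\<^sup>2) = sqrt 2 * 2"
    by (simp add: power_divide field_simps)
  also have "sqrt 2 * 2 = sqrt (2 * 4)"
    unfolding real_sqrt_mult by simp
  also have "arctan (sqrt (2 * 4)) = pi / 2 - arctan (1 / sqrt 8)"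
    using arctan_inverse[of "sqrt 8"] by (simp add: inverse_eq_divide)
  finally show ?thesis .
qed

definition edge_integrand :: "real \<Rightarrow> real" where
  "edge_integrand a = sqrt ((1 + a\<^sup>2) / (1 - a\<^sup>2)) * arctan (a / (sqrt (1 + a\<^sup>2) + 1))"

text \<open>The half-angle formula for the arctangent. The shorter form is the one that is
  differentiated and expanded later.\<close>

lemma edge_integrand_eq: "edge_integrand a = sqrt ((1 + a\<^sup>2) / (1 - a\<^sup>2)) * arctan a / 2"
  using arctan_half[of a] by (simp add: edge_integrand_def add.commute)

text \<open>The bound 9/10 is a convenient rational between 1 / sqrt 3, where the integration ends,
  and the singularity at 1.\<close>

lemma continuous_on_edge_integrand: "continuous_on {0..9/10} edge_integrand"
proof -
  have "1 - a\<^sup>2 \<noteq> 0" if "a \<in> {0..9/10}" for a :: real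
    using power_mono[of a "9/10" 2] that by (auto simp: power2_eq_square)
  then show ?thesis
    unfolding edge_integrand_eq[abs_def] by (intro continuous_intros) auto
qed

text \<open>On the edge region the substitution \<open>a = sin q / sqrt (1 + (cos q)\<^sup>2)\<close> and one integration
  by parts against \<open>arctan a\<close> turn the inner integrals into \<^const>\<open>edge_integrand\<close>.\<close>

lemma edge_outer_has_integral:
  defines "k \<equiv> \<lambda>q::real. 1 + (cos q)\<^sup>2"
  defines "I \<equiv> \<lambda>q. 8 / 3 * \<bar>sin q\<bar> ^ 3 / k q + 2 * k q * \<bar>sin q\<bar>
      - 4 * sqrt (k q) * arctan (\<bar>sin q\<bar> / sqrt (k q))"
  shows "(I has_integral (48 - 22 * sqrt 2 + 8 * arctan (1 / sqrt 8) - 4 * pi / 3 * sqrt 6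
      - 96 * integral {0..1 / sqrt 3} edge_integrand) / 6) {- (pi / 4)..pi / 4}"
proof -
  define a where "a = (\<lambda>q. sin q / sqrt (k q))"
  define Q where "Q = (\<lambda>x. integral {0..x} edge_integrand)"
  \<comment> \<open>The last term is the integration by parts: the derivative of sin q cos q / sqrt
    k is sqrt k - 2 / (k sqrt k). The surplus 96 arctan a / (k sqrt k) is the derivative of 96
    \<open>Q (a q)\<close>, because \<open>a\<close> has derivative 2 cos q / (k sqrt k) and the
    integrand at \<open>a q\<close> equals arctan a / (2 cos q). Everything is scaled by 12, for six
    edges and two symmetric halves of the q-interval.\<close>
  define E where "E = (\<lambda>q. - 40 * cos q - 8 * (cos q) ^ 3 - 16 * arctan (cos q)
      - 48 * (arctan (a q) * (sin q * (cos q / sqrt (k q)))))"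
  have k: "1 \<le> k q" "k q \<le> 2" "0 < sqrt (k q)" "(sqrt (k q))\<^sup>2 = k q" "sqrt (k q) * sqrt (k q) = k q" "0 < k q" for q
    unfolding k_def using abs_square_le_1[of "cos q"] by (auto intro: add_pos_nonneg)
  have ks: "k q + (sin q)\<^sup>2 = 2" for q
    using sin_cos_squared_add[of q] by (simp add: k_def)
  have a2: "1 + (a q)\<^sup>2 = 2 / k q" for q
    using k(4,6)[of q] ks[of q] by (simp add: a_def power_divide field_simps)
  have sq': "((\<lambda>q. sqrt (k q)) has_real_derivative - (cos q * sin q) / sqrt (k q)) (at q)" for q
    using k(6)[of q] unfolding k_def by (auto intro!: derivative_eq_intros simp: field_simps)
  have a': "(a has_real_derivative 2 * cos q / (k q * sqrt (k q))) (at q)" for q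
  proof -
    have "(a has_real_derivative (cos q * sqrt (k q) - sin q * (- (cos q * sin q) / sqrt (k q))) / (sqrt (k q) * sqrt (k q))) (at q)"
      unfolding a_def using k(3)[of q] by (intro DERIV_divide DERIV_sin sq') auto
    also have "(cos q * sqrt (k q) - sin q * (- (cos q * sin q) / sqrt (k q))) = cos q * (k q + (sin q)\<^sup>2) / sqrt (k q)"
      using k(3,5)[of q] by (simp add: field_simps power2_eq_square)
    also have "\<dots> / (sqrt (k q) * sqrt (k q)) = 2 * cos q / (k q * sqrt (k q))"
      unfolding ks k(5) by (simp add: mult.commute)
    finally show ?thesis .
  qed
  have sin0: "0 \<le> sin q" and cos0: "0 < cos q" if "q \<in> {0..pi/4}" for q
    using that pi_gt_zero by (auto intro!: sin_ge_zero cos_gt_zero_pi simp del: pi_gt_zero)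
  have a_range: "0 \<le> a q" "a q \<le> 9 / 10" if "q \<in> {0..pi/4}" for q
  proof -
    show "0 \<le> a q" using sin0[OF that] k(3)[of q] by (simp add: a_def)
    have "sin q \<le> sin (pi / 4)"
      using that pi_gt_zero by (intro sin_monotone_2pi_le) (auto simp del: pi_gt_zero)
    then have "(sin q)\<^sup>2 \<le> (sin (pi / 4))\<^sup>2"
      using sin0[OF that] by (intro power_mono) auto
    then have "(sin q)\<^sup>2 \<le> 1 / 2"
      by (simp add: sin_45 power_divide)
    then have "3 / 2 \<le> k q"
      using ks[of q] by simp
    then have "2 / k q \<le> 2 / (3 / 2)"
      by (intro divide_left_mono) auto
    then have "(a q)\<^sup>2 \<le> (9 / 10)\<^sup>2"
      using a2[of q] by (simp add: power2_eq_square)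
    then show "a q \<le> 9 / 10"
      by (rule power2_le_imp_le) simp
  qed
  have int_a: "edge_integrand (a q) = arctan (a q) / (2 * cos q)" if "q \<in> {0..pi/4}" for q
  proof -
    have "(cos q)\<^sup>2 = k q - 1" by (simp add: k_def)
    moreover have "1 - (a q)\<^sup>2 = 2 - 2 / k q"
      using a2[of q] by simp
    ultimately have a2': "1 - (a q)\<^sup>2 = 2 * (cos q)\<^sup>2 / k q"
      using k(6)[of q] by (simp add: field_simps)
    have "(1 + (a q)\<^sup>2) / (1 - (a q)\<^sup>2) = (1 / cos q)\<^sup>2"
      unfolding a2 a2' using k(6)[of q] by (simp add: power_divide)
    then show ?thesis
      using cos0[OF that] by (simp add: edge_integrand_eq)
  qed
  have Q': "((\<lambda>q. Q (a q)) has_real_derivative arctan (a q) / (k q * sqrt (k q))) (at q within {0..pi/4})"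
    if q: "q \<in> {0..pi/4}" for q
  proof -
    have "(Q has_real_derivative edge_integrand (a q)) (at (a q) within {0..9/10})"
      unfolding Q_def using a_range[OF q]
      by (intro integral_has_real_derivative continuous_on_edge_integrand) auto
    then have "(Q has_real_derivative edge_integrand (a q)) (at (a q) within a ` {0..pi/4})"
      by (rule DERIV_subset) (use a_range in auto)
    then have "(Q \<circ> a has_real_derivative edge_integrand (a q) * (2 * cos q / (k q * sqrt (k q)))) (at q within {0..pi/4})"
      by (rule DERIV_image_chain) (rule has_field_derivative_at_within[OF a'])
    then show ?thesis
      using cos0[OF q] by (simp add: int_a[OF q] o_def field_simps)
  qed
  have E': "(E has_real_derivative 12 * I q + 96 * (arctan (a q) / (k q * sqrt (k q)))) (at q)"
    if q: "q \<in> {0..pi/4}" for q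
  proof -
    have d1: "((\<lambda>q. cos q / sqrt (k q)) has_real_derivative
        (- sin q * sqrt (k q) - cos q * (- (cos q * sin q) / sqrt (k q))) / (sqrt (k q) * sqrt (k q))) (at q)"
      using k(3)[of q] by (intro DERIV_divide DERIV_cos sq') auto
    have e1: "(- sin q * sqrt (k q) - cos q * (- (cos q * sin q) / sqrt (k q))) / (sqrt (k q) * sqrt (k q))
        = - sin q / (k q * sqrt (k q))"
    proof -
      have "- sin q * sqrt (k q) - cos q * (- (cos q * sin q) / sqrt (k q)) = - sin q * (k q - (cos q)\<^sup>2) / sqrt (k q)"
        using k(3,5)[of q] by (simp add: field_simps power2_eq_square)
      then show ?thesis
        unfolding k(5) by (simp add: k_def)
    qed
    have d2: "((\<lambda>q. sin q * (cos q / sqrt (k q))) has_real_derivative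
        cos q * (cos q / sqrt (k q)) + (- sin q / (k q * sqrt (k q))) * sin q) (at q)"
      by (rule DERIV_mult[OF DERIV_sin d1[unfolded e1]])
    have e2: "cos q * (cos q / sqrt (k q)) + (- sin q / (k q * sqrt (k q))) * sin q
        = sqrt (k q) - 2 / (k q * sqrt (k q))"
    proof -
      have "(cos q)\<^sup>2 * k q - (sin q)\<^sup>2 = k q * k q - 2"
        using ks[of q] by (simp add: k_def algebra_simps power2_eq_square)
      then have "((cos q)\<^sup>2 * k q - (sin q)\<^sup>2) / (k q * sqrt (k q)) = (k q * k q - 2) / (k q * sqrt (k q))"
        by simp
      moreover have "k q * k q / (k q * sqrt (k q)) = sqrt (k q)"
        using k(3,5,6)[of q] by (simp add: field_simps)
      ultimately show ?thesis
        using k(3,6)[of q] by (simp add: diff_divide_distrib power2_eq_square)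
    qed
    have d3: "((\<lambda>q. arctan (a q)) has_real_derivative 1 / (1 + (a q)\<^sup>2) * (2 * cos q / (k q * sqrt (k q)))) (at q)"
      by (rule DERIV_cong[OF DERIV_chain2[OF DERIV_arctan a']]) (simp add: divide_inverse)
    have e3: "1 / (1 + (a q)\<^sup>2) * (2 * cos q / (k q * sqrt (k q))) = cos q / sqrt (k q)"
      unfolding a2 using k(6)[of q] by simp
    note d4 = DERIV_mult[OF d3[unfolded e3] d2[unfolded e2]]
    have e4: "cos q / sqrt (k q) * (sin q * (cos q / sqrt (k q))) = sin q * (cos q)\<^sup>2 / k q"
      using k(5)[of q] by (simp add: power2_eq_square)
    have "(E has_real_derivative 40 * sin q + 24 * (cos q)\<^sup>2 * sin q + 16 * sin q / k q
      - 48 * (sin q * (cos q)\<^sup>2 / k q + (sqrt (k q) - 2 / (k q * sqrt (k q))) * arctan (a q))) (at q)"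
    proof -
      have p: "((\<lambda>q. - 40 * cos q - 8 * (cos q) ^ 3 - 16 * arctan (cos q)) has_real_derivative
        40 * sin q + 24 * (cos q)\<^sup>2 * sin q + 16 * sin q / k q) (at q)"
        unfolding k_def by (auto intro!: derivative_eq_intros simp: divide_inverse)
      show ?thesis
        unfolding E_def by (rule DERIV_diff[OF p DERIV_cmult[OF d4[unfolded e4]]])
    qed
    also have "40 * sin q + 24 * (cos q)\<^sup>2 * sin q + 16 * sin q / k q
      - 48 * (sin q * (cos q)\<^sup>2 / k q + (sqrt (k q) - 2 / (k q * sqrt (k q))) * arctan (a q))
      = 12 * I q + 96 * (arctan (a q) / (k q * sqrt (k q)))"
    proof -
      have c: "(cos q)\<^sup>2 = k q - 1" and s: "(sin q)\<^sup>2 = 2 - k q"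
        using ks[of q] by (simp add: k_def, linarith)
      have abs: "\<bar>sin q\<bar> = sin q" using sin0[OF q] by simp
      have s3: "sin q ^ 3 = sin q * (2 - k q)"
        using s by (simp add: power3_eq_cube power2_eq_square mult.assoc)
      have f1: "8 / 3 * \<bar>sin q\<bar> ^ 3 / k q = 16 / 3 * (sin q / k q) - 8 / 3 * sin q"
        unfolding abs s3 using k(6)[of q] by (simp add: field_simps)
      have f2: "sin q * (cos q)\<^sup>2 / k q = sin q - sin q / k q"
        unfolding c using k(6)[of q] by (simp add: field_simps)
      have f3: "sin q / sqrt (k q) = a q"
        by (simp add: a_def)
      show ?thesis
        unfolding I_def unfolding f1 f2 unfolding abs f3 c
        by (simp add: algebra_simps)
    qed
    finally show ?thesis .
  qed
  have Ihalf: "((\<lambda>q. 12 * I q) has_integral (E (pi/4) - 96 * Q (a (pi/4))) - (E 0 - 96 * Q (a 0))) {0..pi/4}"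
  proof (rule fundamental_theorem_of_calculus)
    fix q assume q: "q \<in> {0..pi/4}"
    have "((\<lambda>q. E q - 96 * Q (a q)) has_real_derivative
        (12 * I q + 96 * (arctan (a q) / (k q * sqrt (k q)))) - 96 * (arctan (a q) / (k q * sqrt (k q)))) (at q within {0..pi/4})"
      by (intro DERIV_diff DERIV_cmult Q'[OF q] has_field_derivative_at_within[OF E'[OF q]])
    then show "((\<lambda>q. E q - 96 * Q (a q)) has_vector_derivative 12 * I q) (at q within {0..pi/4})"
      by (simp add: has_real_derivative_iff_has_vector_derivative)
  qed simp
  have "a 0 = 0" by (simp add: a_def)
  then have zero: "Q (a 0) = 0" "E 0 = - 48 - 4 * pi"
    by (simp_all add: Q_def E_def k_def arctan_one)
  have "E (pi/4) - 96 * Q (a (pi/4)) = - 22 * sqrt 2 - 8 * (2 * arctan (1 / sqrt 2)) - 4 * pi / 3 * sqrt 6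
      - 96 * integral {0..1 / sqrt 3} edge_integrand"
  proof -
    have kp: "k (pi/4) = 3 / 2"
      by (simp add: k_def cos_45 power_divide)
    have c: "cos (pi/4) = 1 / sqrt 2" "sin (pi/4) = 1 / sqrt 2"
      by (simp_all add: cos_45 sin_45 field_simps)
    have ap: "a (pi/4) = 1 / sqrt 3"
      unfolding a_def kp c by (simp add: real_sqrt_divide)
    have at3: "arctan (1 / sqrt 3) = pi / 6"
      by (rule arctan_unique) (auto simp: tan_30)
    have sqrt6: "sqrt 6 = sqrt 2 * sqrt 3"
      by (simp flip: real_sqrt_mult)
    have cube: "cos (pi/4) ^ 3 = sqrt 2 / 4"
      unfolding cos_45 by (simp add: power3_eq_cube)
    have prod: "sin (pi/4) * (cos (pi/4) / sqrt (3 / 2)) = sqrt 2 * sqrt 3 / 6"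
      unfolding cos_45 sin_45 by (simp add: real_sqrt_divide field_simps)
    have "E (pi/4) = - 40 * (sqrt 2 / 2) - 8 * (sqrt 2 / 4) - 16 * arctan (1 / sqrt 2)
        - 48 * (pi / 6 * (sqrt 2 * sqrt 3 / 6))"
      unfolding E_def ap kp cube prod at3 unfolding c(1)[symmetric] unfolding cos_45 by (rule refl)
    then show ?thesis
      unfolding Q_def ap sqrt6 by simp
  qed
  then have "(E (pi/4) - 96 * Q (a (pi/4))) - (E 0 - 96 * Q (a 0)) =
      48 - 22 * sqrt 2 + 8 * arctan (1 / sqrt 8) - 4 * pi / 3 * sqrt 6
      - 96 * integral {0..1 / sqrt 3} edge_integrand" (is "_ = ?V")
    unfolding zero arctan_inverse_sqrt_2 by simp
  with Ihalf have "((\<lambda>q. 12 * I q) has_integral ?V) {0..pi/4}" by simp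
  from has_integral_mult_right[OF this, of "1/12"]
  have half: "(I has_integral ?V / 12) {0..pi/4}" by simp
  have "I (- q) = I q" for q
    by (simp add: I_def k_def)
  then have "(I has_integral ?V / 12) {- (pi/4)..0}"
    using has_integral_reflect_real[of I "?V / 12" "pi/4" 0] half by simp
  from has_integral_combine[OF _ _ this half] show ?thesis
    by simp
qed

text \<open>The opening angle is 2 arctan (1 / sqrt 2), the dihedral angle of the tetrahedron, and
  the radius is 2.\<close>

lemma measure_lune:
  defines "S \<equiv> {y. 0 < y$1 \<and> \<bar>y$2\<bar> < arctan (1 / sqrt 2) \<and> (y$3)\<^sup>2 \<le> 4 - (y$1)\<^sup>2}"
  shows "ell_cyl 1 0 1 0 ` S \<in> lmeasurable"
    and "measure lebesgue (ell_cyl 1 0 1 0 ` S) = 32 / 3 * arctan (1 / sqrt 2)"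
proof -
  have k: "1\<^sup>2 * (cos q)\<^sup>2 + 1\<^sup>2 * (sin q)\<^sup>2 = (1::real)" for q
    by simp
  have j: "ell_jac 1 0 1 0 r q = r" for r q
    by (simp add: ell_jac_def flip: distrib_left)
  have "((\<lambda>q. 16 / 3) has_integral 32 / 3 * arctan (1 / sqrt 2)) {- arctan (1 / sqrt 2)..arctan (1 / sqrt 2)}"
    using has_integral_const_real[of "16 / 3 :: real" "- arctan (1 / sqrt 2)" "arctan (1 / sqrt 2)"]
    by (simp add: algebra_simps)
  then have "ell_cyl 1 0 1 0 ` S \<in> lmeasurable \<and>
      measure lebesgue (ell_cyl 1 0 1 0 ` S) = 32 / 3 * arctan (1 / sqrt 2)"
    using measure_ell_cyl[of 1 1 0 0 0 "arctan (1 / sqrt 2)" "\<lambda>q. 16 / 3" "32 / 3 * arctan (1 / sqrt 2)"]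
      lune_has_integral arctan_ubound[of "1 / sqrt 2"]
    unfolding k j S_def by simp
  then show "ell_cyl 1 0 1 0 ` S \<in> lmeasurable"
    and "measure lebesgue (ell_cyl 1 0 1 0 ` S) = 32 / 3 * arctan (1 / sqrt 2)"
    by blast+
qed

lemma measure_edge:
  defines "S \<equiv> {y. sqrt 2 < y$1 \<and> \<bar>y$2\<bar> < pi / 4 \<and> (y$3)\<^sup>2 \<le> 4 - (1 + (cos (y$2))\<^sup>2) * (y$1)\<^sup>2}"
  shows "ell_cyl (sqrt 2) 1 1 (sqrt 2) ` S \<in> lmeasurable"
    and "measure lebesgue (ell_cyl (sqrt 2) 1 1 (sqrt 2) ` S) =
      (48 - 22 * sqrt 2 + 8 * arctan (1 / sqrt 8) - 4 * pi / 3 * sqrt 6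
      - 96 * integral {0..1 / sqrt 3} edge_integrand) / 6" (is "_ = ?V")
proof -
  have k: "(sqrt 2)\<^sup>2 * (cos q)\<^sup>2 + 1\<^sup>2 * (sin q)\<^sup>2 = 1 + (cos q)\<^sup>2" for q
    using sin_cos_squared_add[of q] by simp
  have j: "ell_jac (sqrt 2) 1 1 (sqrt 2) r q = sqrt 2 * r - (1 + (cos q)\<^sup>2)" for r q
    unfolding ell_jac_def sin_squared_eq by (simp add: algebra_simps)
  have inner: "((\<lambda>r. 2 * sqrt (4 - (1 + (cos q)\<^sup>2) * r\<^sup>2) * (sqrt 2 * r - (1 + (cos q)\<^sup>2))) has_integral
      8 / 3 * \<bar>sin q\<bar> ^ 3 / (1 + (cos q)\<^sup>2) + 2 * (1 + (cos q)\<^sup>2) * \<bar>sin q\<bar> -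
      4 * sqrt (1 + (cos q)\<^sup>2) * arctan (\<bar>sin q\<bar> / sqrt (1 + (cos q)\<^sup>2))) {sqrt 2..2 / sqrt (1 + (cos q)\<^sup>2)}" for q
    using abs_square_le_1[of "cos q"] by (intro edge_inner_has_integral) (auto simp: sin_squared_eq)
  have "ell_cyl (sqrt 2) 1 1 (sqrt 2) ` S \<in> lmeasurable \<and>
      measure lebesgue (ell_cyl (sqrt 2) 1 1 (sqrt 2) ` S) = ?V"
    unfolding S_def
  proof (rule measure_ell_cyl[of "sqrt 2" 1 "sqrt 2" 1 "sqrt 2" "pi / 4", unfolded k j])
    show "((\<lambda>q. 8 / 3 * \<bar>sin q\<bar> ^ 3 / (1 + (cos q)\<^sup>2) + 2 * (1 + (cos q)\<^sup>2) * \<bar>sin q\<bar> -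
      4 * sqrt (1 + (cos q)\<^sup>2) * arctan (\<bar>sin q\<bar> / sqrt (1 + (cos q)\<^sup>2))) has_integral ?V) {- (pi / 4)..pi / 4}"
      by (rule edge_outer_has_integral)
  qed (use inner in auto)
  then show "ell_cyl (sqrt 2) 1 1 (sqrt 2) ` S \<in> lmeasurable"
    and "measure lebesgue (ell_cyl (sqrt 2) 1 1 (sqrt 2) ` S) = ?V"
    by blast+
qed

subsection \<open>Isometries, permutations and the pieces of the body\<close>

lemma ones_perp_iff: "p \<in> ones_perp \<longleftrightarrow> (\<Sum>i\<in>UNIV. p $ i) = 0"
  by (simp add: ones_perp_def orthogonal_comp_def orthogonal_def inner_vec_def)

text \<open>Two identifications of the hyperplane differ by the orthogonal map \<open>h\<close> of
  3-space, which preserves volume. All volumes can therefore be computed in one convenient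
  chart.\<close>

lemma ones_perp_isometry_vimage:
  assumes f: "ones_perp_isometry f" and g: "ones_perp_isometry g" and X: "g -` X \<in> lmeasurable"
  shows "f -` X \<in> lmeasurable" "measure lebesgue (f -` X) = measure lebesgue (g -` X)"
proof -
  have "inj f" if "ones_perp_isometry f" for f
    using that unfolding ones_perp_isometry_def
    by (metis linear_injective_0 norm_eq_zero)
  then obtain f' where f': "linear f'" "f' \<circ> f = id"
    using linear_injective_left_inverse f unfolding ones_perp_isometry_def by blast
  have ff': "f (f' z) = z" if "z \<in> ones_perp" for z
  proof -
    obtain y where "z = f y"
      using f \<open>z \<in> ones_perp\<close> unfolding ones_perp_isometry_def by blast
    then show ?thesis
      using f'(2) by (simp add: fun_eq_iff)
  qed
  have g_in: "g y \<in> ones_perp" for y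
    using g unfolding ones_perp_isometry_def by blast
  define h where "h = f' \<circ> g"
  have "norm (h y) = norm y" for y
    using f g ff'[OF g_in[of y]] unfolding h_def ones_perp_isometry_def
    by (metis comp_apply)
  moreover have "linear h"
    unfolding h_def using f'(1) g by (simp add: linear_compose ones_perp_isometry_def)
  ultimately have h: "orthogonal_transformation h"
    by (simp add: orthogonal_transformation)
  have "f -` X = h ` (g -` X)"
  proof -
    have "f (h y) = g y" for y
      by (simp add: h_def ff' g_in)
    then have "g -` X = h -` (f -` X)"
      by auto
    then show ?thesis
      using orthogonal_transformation_surj[OF h] by (simp add: surj_image_vimage_eq)
  qed
  then show "f -` X \<in> lmeasurable" "measure lebesgue (f -` X) = measure lebesgue (g -` X)"
    using measurable_orthogonal_image[OF h X] measure_orthogonal_image[OF h X] by simp_all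
qed

section \<open>Invariance under coordinate permutations, and the pieces of the body\<close>

definition permute_vec :: "('n \<Rightarrow> 'n) \<Rightarrow> real ^ 'n \<Rightarrow> real ^ 'n" where
  "permute_vec \<pi> x = (\<chi> i. x $ \<pi> i)"

lemma linear_permute_vec: "linear (permute_vec \<pi>)"
  by (rule linearI) (simp_all add: permute_vec_def vec_eq_iff)

lemma norm_permute_vec: "bij \<pi> \<Longrightarrow> norm (permute_vec \<pi> (x :: real ^ 'n)) = norm x"
  by (simp add: permute_vec_def norm_vec_def L2_set_def sum.reindex_bij_betw[of \<pi> UNIV UNIV "\<lambda>i. (x $ i)\<^sup>2"])

lemma permute_vec_inv: "bij \<pi> \<Longrightarrow> permute_vec \<pi> (permute_vec (inv \<pi>) x) = x"
  "bij \<pi> \<Longrightarrow> permute_vec (inv \<pi>) (permute_vec \<pi> x) = x"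
  by (simp_all add: permute_vec_def vec_eq_iff bij_is_inj bij_is_surj surj_f_inv_f)

lemma permute_vec_ones_perp: "bij \<pi> \<Longrightarrow> permute_vec \<pi> p \<in> ones_perp \<longleftrightarrow> p \<in> ones_perp"
  by (simp add: ones_perp_iff permute_vec_def sum.reindex_bij_betw[of \<pi> UNIV UNIV "\<lambda>i. p $ i"])

lemma ones_perp_isometry_permute:
  assumes f: "ones_perp_isometry f" and \<pi>: "bij \<pi>"
  shows "ones_perp_isometry (permute_vec \<pi> \<circ> f)"
proof -
  have "permute_vec \<pi> ` ones_perp = ones_perp"
  proof safe
    fix p assume "p \<in> ones_perp"
    then have "permute_vec (inv \<pi>) p \<in> ones_perp"
      using \<pi> by (simp add: permute_vec_ones_perp bij_imp_bij_inv)
    then show "p \<in> permute_vec \<pi> ` ones_perp"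
      using permute_vec_inv(1)[OF \<pi>, of p] by (metis imageI)
  qed (use \<pi> in \<open>simp add: permute_vec_ones_perp\<close>)
  then have "range (permute_vec \<pi> \<circ> f) = ones_perp"
    using f unfolding ones_perp_isometry_def by (metis image_comp)
  then show ?thesis
    using f \<pi> unfolding ones_perp_isometry_def
    by (simp add: linear_compose linear_permute_vec norm_permute_vec)
qed

text \<open>An identification followed by a coordinate permutation is again an identification of the
  hyperplane, so independence of the chosen identification already contains the symmetry.\<close>

lemma measure_vimage_permute:
  assumes f: "ones_perp_isometry f" and \<pi>: "bij \<pi>" and X: "f -` X \<in> lmeasurable"
  shows "f -` (permute_vec \<pi> -` X) \<in> lmeasurable"
    "measure lebesgue (f -` (permute_vec \<pi> -` X)) = measure lebesgue (f -` X)"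
  using ones_perp_isometry_vimage[OF ones_perp_isometry_permute[OF f \<pi>] f X]
  by (simp_all add: vimage_comp)

text \<open>The fibre of the projection over p is the line of all \<open>p + vec t\<close>.\<close>

lemma U3_iff: "p \<in> U3 \<longleftrightarrow> p \<in> ones_perp \<and> (\<exists>t. p + vec t \<in> M4)"
proof -
  have sub: "subspace ones_perp"
    by (simp add: ones_perp_def subspace_orthogonal_comp)
  have proj: "orth_proj ones_perp (p + vec t) = p" if "p \<in> ones_perp" for p t
  proof (rule orth_proj_unique[OF sub that])
    show "p + vec t - p \<in> ones_perp\<^sup>\<bottom>"
      by (auto simp: orthogonal_comp_def orthogonal_def inner_vec_def ones_perp_iff
          simp flip: sum_distrib_left sum_distrib_right)
  qed
  show ?thesis
  proof
    assume "p \<in> U3"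
    then obtain x where x: "x \<in> M4" "p = orth_proj ones_perp x"
      unfolding U3_def by blast
    define t where "t = (\<Sum>i\<in>UNIV. x $ i) / 4"
    have "x - vec t \<in> ones_perp"
      by (simp add: ones_perp_iff sum_subtractf t_def)
    from proj[OF this, of t] have "p = x - vec t"
      using x(2) by simp
    then show "p \<in> ones_perp \<and> (\<exists>t. p + vec t \<in> M4)"
      using \<open>x - vec t \<in> ones_perp\<close> x(1) by (auto intro!: exI[of _ t])
  next
    assume "p \<in> ones_perp \<and> (\<exists>t. p + vec t \<in> M4)"
    then show "p \<in> U3"
      unfolding U3_def using proj by (metis imageI)
  qed
qed

lemma permute_vec_M4: "bij \<pi> \<Longrightarrow> x \<in> M4 \<Longrightarrow> permute_vec \<pi> x \<in> M4"
proof -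
  assume \<pi>: "bij \<pi>" and "x \<in> M4"
  then obtain v w where vw: "x = v - w" "v \<in> nonneg_orthant" "w \<in> nonneg_orthant"
    "(norm v)\<^sup>2 + (norm w + sqrt 2)\<^sup>2 \<le> 4"
    unfolding M4_def by blast
  show ?thesis
    unfolding M4_def mem_Collect_eq
  proof (intro exI conjI)
    show "permute_vec \<pi> x = permute_vec \<pi> v - permute_vec \<pi> w"
      by (simp add: vw permute_vec_def vec_eq_iff)
  qed (use vw \<pi> in \<open>simp_all add: norm_permute_vec nonneg_orthant_def permute_vec_def[of \<pi>]\<close>,
      simp_all add: norm_permute_vec[unfolded permute_vec_def])
qed

lemma permute_vec_U3: "permute_vec \<pi> p \<in> U3 \<longleftrightarrow> p \<in> U3" if \<pi>: "bij \<pi>"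
proof -
  have *: "permute_vec \<pi> p \<in> U3" if \<pi>: "bij \<pi>" and p: "p \<in> U3" for \<pi> p
  proof -
    obtain t where "p + vec t \<in> M4"
      using p by (auto simp: U3_iff)
    then have "permute_vec \<pi> (p + vec t) \<in> M4"
      by (rule permute_vec_M4[OF \<pi>])
    also have "permute_vec \<pi> (p + vec t) = permute_vec \<pi> p + vec t"
      by (simp add: permute_vec_def vec_eq_iff)
    finally show ?thesis
      using p \<pi> by (auto simp: U3_iff permute_vec_ones_perp)
  qed
  from *[OF \<pi>, of p] *[OF bij_imp_bij_inv[OF \<pi>], of "permute_vec \<pi> p"] show ?thesis
    by (auto simp: permute_vec_inv[OF \<pi>])
qed

text \<open>The threshold is the facet plane s_i = 0 of the tetrahedron, written without the
  shift.\<close>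

definition U3_piece :: "4 set \<Rightarrow> (real ^ 4) set" where
  "U3_piece N = {p \<in> U3. {i. p $ i < - (sqrt 2 / 4)} = N}"

lemma permute_vec_U3_piece: "permute_vec \<pi> -` U3_piece N = U3_piece (\<pi> ` N)" if \<pi>: "bij \<pi>"
proof -
  have "{i. p $ \<pi> i < c} = N \<longleftrightarrow> {i. p $ i < c} = \<pi> ` N" for p :: "real ^ 4" and c
  proof -
    have "{i. p $ \<pi> i < c} = \<pi> -` {i. p $ i < c}"
      by auto
    then show ?thesis
      using \<pi> by (metis bij_is_inj bij_is_surj inj_vimage_image_eq surj_image_vimage_eq)
  qed
  then show ?thesis
    using permute_vec_U3[OF \<pi>] by (auto simp: U3_piece_def permute_vec_def)
qed

lemma bij_betw_extend_finite:
  fixes h :: "'n::finite \<Rightarrow> 'n"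
  assumes h: "bij_betw h N N'"
  obtains \<pi> where "bij \<pi>" "\<And>i. i \<in> N \<Longrightarrow> \<pi> i = h i"
proof -
  have "card (- N) = card (- N')"
    using bij_betw_same_card[OF h] by (simp add: Compl_eq_Diff_UNIV card_Diff_subset)
  then obtain h' where h': "bij_betw h' (- N) (- N')"
    by (metis finite finite_same_card_bij)
  have "bij_betw (\<lambda>i. if i \<in> N then h i else h' i) (N \<union> - N) (N' \<union> - N')"
    by (rule bij_betw_disjoint_Un[OF h h']) auto
  then show ?thesis
    by (intro that[of "\<lambda>i. if i \<in> N then h i else h' i"]) simp_all
qed

text \<open>A bijection between the index sets extends to a permutation of all four coordinates,
  which carries one piece to the other. Only one piece per cardinality has to be measured.\<close>

lemma measure_U3_piece_card:
  assumes f: "ones_perp_isometry f" and N: "card N = card N'" and X: "f -` U3_piece N \<in> lmeasurable"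
  shows "f -` U3_piece N' \<in> lmeasurable"
    "measure lebesgue (f -` U3_piece N') = measure lebesgue (f -` U3_piece N)"
proof -
  obtain h where h: "bij_betw h N N'"
    using N by (metis finite finite_same_card_bij)
  from bij_betw_extend_finite[OF h] obtain \<pi> where \<pi>: "bij \<pi>" "\<And>i. i \<in> N \<Longrightarrow> \<pi> i = h i"
    by blast
  have "\<pi> ` N = N'"
    using h \<pi>(2) by (simp add: bij_betw_def cong: image_cong_simp)
  then show "f -` U3_piece N' \<in> lmeasurable"
    "measure lebesgue (f -` U3_piece N') = measure lebesgue (f -` U3_piece N)"
    using measure_vimage_permute[OF f \<pi>(1) X] \<pi>(1) by (simp_all add: permute_vec_U3_piece)
qed

section \<open>Necessary ball conditions and explicit decompositions\<close>

lemma power2_norm_vec: "(norm x)\<^sup>2 = (\<Sum>i\<in>UNIV. (x $ i)\<^sup>2)" for x :: "real ^ 'n"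
  unfolding power2_norm_eq_inner by (simp add: inner_vec_def power2_eq_square)

text \<open>In the expansion of |v - (w + sqrt 2 e)|^2 the cross term has a favourable sign because
  all vectors lie in the orthant, and |w + sqrt 2 e| is at most |w| + sqrt 2.\<close>

lemma M4_ball:
  assumes "x \<in> M4" "e \<in> nonneg_orthant" "norm e = 1"
  shows "norm (x - sqrt 2 *\<^sub>R e) \<le> 2"
proof -
  obtain v w where vw: "x = v - w" "v \<in> nonneg_orthant" "w \<in> nonneg_orthant"
    "(norm v)\<^sup>2 + (norm w + sqrt 2)\<^sup>2 \<le> 4"
    using assms(1) unfolding M4_def by blast
  have "norm (w + sqrt 2 *\<^sub>R e) \<le> norm w + sqrt 2"
    using norm_triangle_ineq[of w "sqrt 2 *\<^sub>R e"] assms(3) by simp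
  then have "(norm (w + sqrt 2 *\<^sub>R e))\<^sup>2 \<le> (norm w + sqrt 2)\<^sup>2"
    by (intro power_mono) auto
  moreover have "0 \<le> v \<bullet> (w + sqrt 2 *\<^sub>R e)"
    using vw(2,3) assms(2) unfolding inner_vec_def nonneg_orthant_def
    by (auto intro!: sum_nonneg mult_nonneg_nonneg)
  moreover have "(norm (x - sqrt 2 *\<^sub>R e))\<^sup>2 =
      (norm v)\<^sup>2 + (norm (w + sqrt 2 *\<^sub>R e))\<^sup>2 - 2 * (v \<bullet> (w + sqrt 2 *\<^sub>R e))"
    unfolding vw(1) by (simp add: power2_norm_eq_inner algebra_simps inner_commute)
  ultimately have "(norm (x - sqrt 2 *\<^sub>R e))\<^sup>2 \<le> 4"
    using vw(4) by linarith
  then have "(norm (x - sqrt 2 *\<^sub>R e))\<^sup>2 \<le> 2\<^sup>2"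
    by simp
  then show ?thesis
    by (rule power2_le_imp_le) simp
qed

lemma U3_ball:
  assumes "p \<in> U3" "e \<in> nonneg_orthant" "norm e = 1"
  obtains t where "(\<Sum>i\<in>UNIV. (p $ i + t - sqrt 2 * e $ i)\<^sup>2) \<le> 4"
proof -
  obtain t where "p + vec t \<in> M4"
    using assms(1) by (auto simp: U3_iff)
  from M4_ball[OF this assms(2,3)] have "(norm (p + vec t - sqrt 2 *\<^sub>R e))\<^sup>2 \<le> 2\<^sup>2"
    by (intro power_mono) auto
  then show ?thesis
    by (intro that[of t]) (simp add: power2_norm_vec)
qed

definition shifted :: "real ^ 4 \<Rightarrow> 4 \<Rightarrow> real" where
  "shifted p i = p $ i + sqrt 2 / 4"

lemma sum_shifted: "p \<in> ones_perp \<Longrightarrow> (\<Sum>i\<in>UNIV. shifted p i) = sqrt 2"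
  by (simp add: ones_perp_iff shifted_def sum.distrib)

lemma U3_vertex_ball:
  assumes p: "p \<in> U3"
  shows "(\<Sum>i\<in>UNIV. (shifted p i)\<^sup>2) \<le> 2 + 2 * sqrt 2 * shifted p j"
proof -
  have "axis j 1 \<in> nonneg_orthant" "norm (axis j 1 :: real ^ 4) = 1"
    by (simp_all add: nonneg_orthant_def axis_def norm_axis_1[unfolded axis_def])
  from U3_ball[OF p this] obtain t
    where "(\<Sum>i\<in>UNIV. (p $ i + t - sqrt 2 * axis j 1 $ i)\<^sup>2) \<le> 4"
    by blast
  moreover define r where "r = t - sqrt 2 / 4"
  ultimately have le: "(\<Sum>i\<in>UNIV. (shifted p i + r - (if i = j then sqrt 2 else 0))\<^sup>2) \<le> 4"
    by (simp add: shifted_def axis_def if_distrib cong: if_cong) 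
  have "(\<Sum>i\<in>UNIV. (shifted p i + r - (if i = j then sqrt 2 else 0))\<^sup>2)
      = (\<Sum>i\<in>UNIV. (shifted p i)\<^sup>2 + (2 * r * shifted p i + (r\<^sup>2 +
          (if i = j then 2 - 2 * sqrt 2 * shifted p i - 2 * sqrt 2 * r else 0))))"
    by (intro sum.cong refl) (simp add: power2_eq_square algebra_simps)
  also have "\<dots> = (\<Sum>i\<in>UNIV. (shifted p i)\<^sup>2) + (2 * r * sqrt 2 + (4 * r\<^sup>2 + (2 - 2 * sqrt 2 * shifted p j - 2 * sqrt 2 * r)))"
    using p by (simp add: sum.distrib sum_shifted U3_iff flip: sum_distrib_left)
  also have "\<dots> = (\<Sum>i\<in>UNIV. (shifted p i)\<^sup>2) + 4 * r\<^sup>2 + 2 - 2 * sqrt 2 * shifted p j"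
    by simp
  finally show ?thesis
    using le zero_le_power2[of r] by linarith
qed

lemma U3_piece_iff: "p \<in> U3_piece N \<longleftrightarrow> p \<in> U3 \<and> {i. shifted p i < 0} = N"
proof -
  have "p $ i < - (sqrt 2 / 4) \<longleftrightarrow> shifted p i < 0" for i
    unfolding shifted_def by linarith
  then show ?thesis by (simp add: U3_piece_def)
qed

text \<open>With at most one non-negative coordinate, the sum sqrt 2 forces that coordinate above
  sqrt 2, so the sum of squares exceeds 2. The ball at a vertex with a negative coordinate keeps it
  below 2.\<close>

lemma U3_piece_empty:
  assumes N: "3 \<le> card N"
  shows "U3_piece N = {}"
proof -
  have False if p: "p \<in> U3" and neg: "{i. shifted p i < 0} = N" for p
  proof -
    have "card (- N) \<le> 1"
      using N by (simp add: Compl_eq_Diff_UNIV card_Diff_subset)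
    then obtain d where d: "- N \<subseteq> {d}"
      by (metis card_1_singletonE card_eq_0_iff finite le_less less_one order_refl subset_insertI subset_empty)
    have "N \<noteq> {}" "N - {d} \<noteq> {}"
      using N card_mono[of "{d}" N] by auto
    then obtain j where j: "j \<in> N - {d}" by blast
    have "(\<Sum>i\<in>UNIV - {d}. shifted p i) < (\<Sum>i\<in>UNIV - {d}. 0)"
      using d neg j by (intro sum_strict_mono) auto
    then have "sqrt 2 < shifted p d"
      using sum_shifted[of p] p sum.remove[of UNIV d "shifted p"] by (simp add: U3_iff)
    then have "(sqrt 2)\<^sup>2 < (shifted p d)\<^sup>2"
      by (intro power_strict_mono) auto
    also have "\<dots> \<le> (\<Sum>i\<in>UNIV. (shifted p i)\<^sup>2)"
      by (rule member_le_sum) auto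
    also have "\<dots> \<le> 2 + 2 * sqrt 2 * shifted p j"
      by (rule U3_vertex_ball[OF p])
    also have "\<dots> < 2"
      using neg j by (auto simp: mult_less_0_iff)
    finally show False by simp
  qed
  then show ?thesis
    using U3_piece_iff by blast
qed

text \<open>Take w = 0 and v = s. All s_i lie between 0 and sqrt 2, so the sum of s_i^2 is at most
  sqrt 2 times the sum of s_i, which is 2.\<close>

lemma U3_simplex:
  assumes p: "p \<in> ones_perp" and nn: "\<And>i. 0 \<le> shifted p i"
  shows "p \<in> U3"
proof -
  define v :: "real ^ 4" where "v = (\<chi> i. shifted p i)"
  have "(\<Sum>i\<in>UNIV. (shifted p i)\<^sup>2) \<le> (\<Sum>i\<in>UNIV. shifted p i * sqrt 2)"
  proof (rule sum_mono)
    fix i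
    have "shifted p i \<le> (\<Sum>i\<in>UNIV. shifted p i)"
      by (rule member_le_sum) (use nn in auto)
    then show "(shifted p i)\<^sup>2 \<le> shifted p i * sqrt 2"
      using sum_shifted[OF p] nn[of i] by (simp add: power2_eq_square mult_left_mono)
  qed
  also have "\<dots> = 2"
    using sum_shifted[OF p] by (simp flip: sum_distrib_right)
  finally have "(norm v)\<^sup>2 \<le> 2"
    by (simp add: power2_norm_vec v_def)
  then have "v - 0 \<in> M4"
    unfolding M4_def mem_Collect_eq by (intro exI[of _ v] exI[of _ 0]) (simp add: nonneg_orthant_def v_def nn)
  moreover have "p + vec (sqrt 2 / 4) = v - 0"
    by (simp add: vec_eq_iff v_def shifted_def)
  ultimately show ?thesis
    using p unfolding U3_iff by metis
qed

text \<open>Let w carry the negative coordinate and v the others. Then |v|^2 + (|w| + sqrt 2)^2 is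
  the sum of s_i^2 minus 2 sqrt 2 s_j plus 2, so the necessary ball condition of
  \<open>U3_vertex_ball\<close> is also sufficient here.\<close>

lemma U3_vertex:
  assumes p: "p \<in> ones_perp" and neg: "shifted p j < 0" and nn: "\<And>i. i \<noteq> j \<Longrightarrow> 0 \<le> shifted p i"
    and ball: "(\<Sum>i\<in>UNIV. (shifted p i)\<^sup>2) \<le> 2 + 2 * sqrt 2 * shifted p j"
  shows "p \<in> U3"
proof -
  define v :: "real ^ 4" where "v = (\<chi> i. if i = j then 0 else shifted p i)"
  define w :: "real ^ 4" where "w = (- shifted p j) *\<^sub>R axis j 1"
  have "(norm v)\<^sup>2 = (\<Sum>i\<in>UNIV - {j}. (shifted p i)\<^sup>2)"
    by (simp add: power2_norm_vec v_def sum.remove[of UNIV j])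
  moreover have "norm w = - shifted p j"
    using neg by (simp add: w_def norm_axis_1)
  moreover have "(\<Sum>i\<in>UNIV. (shifted p i)\<^sup>2) = (shifted p j)\<^sup>2 + (\<Sum>i\<in>UNIV - {j}. (shifted p i)\<^sup>2)"
    by (simp add: sum.remove[of UNIV j])
  ultimately have "(norm v)\<^sup>2 + (norm w + sqrt 2)\<^sup>2 \<le> 4"
    using ball by (simp add: power2_eq_square algebra_simps)
  then have "v - w \<in> M4"
    unfolding M4_def mem_Collect_eq using neg nn
    by (intro exI[of _ v] exI[of _ w]) (auto simp: nonneg_orthant_def v_def w_def axis_def)
  moreover have "p + vec (sqrt 2 / 4) = v - w"
    by (auto simp: vec_eq_iff v_def w_def axis_def shifted_def)
  ultimately show ?thesis
    using p unfolding U3_iff by metis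
qed

subsection \<open>The tetrahedron and the vertex regions\<close>

lemma measure_Int_halfspace_split:
  fixes n :: "'a::euclidean_space"
  assumes A: "A \<in> lmeasurable" and n: "n \<noteq> 0"
  shows "measure lebesgue (A \<inter> {y. 0 \<le> n \<bullet> y}) + measure lebesgue (A \<inter> {y. n \<bullet> y \<le> 0}) = measure lebesgue A"
proof -
  have m: "A \<inter> {y. 0 \<le> n \<bullet> y} \<in> lmeasurable" "A \<inter> {y. n \<bullet> y \<le> 0} \<in> lmeasurable"
    using A closed_halfspace_ge[of 0 n] closed_halfspace_le[of n 0]
    by (auto intro!: fmeasurable_Int_fmeasurable)
  have "negligible ((A \<inter> {y. 0 \<le> n \<bullet> y}) \<inter> (A \<inter> {y. n \<bullet> y \<le> 0}))"
    by (rule negligible_subset[OF negligible_hyperplane[of n 0]]) (use n in auto)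
  then have "measure lebesgue ((A \<inter> {y. 0 \<le> n \<bullet> y}) \<union> (A \<inter> {y. n \<bullet> y \<le> 0}))
      = measure lebesgue (A \<inter> {y. 0 \<le> n \<bullet> y}) + measure lebesgue (A \<inter> {y. n \<bullet> y \<le> 0})"
    using measure_Un3[OF m] negligible_imp_measure0 by simp
  moreover have "(A \<inter> {y. 0 \<le> n \<bullet> y}) \<union> (A \<inter> {y. n \<bullet> y \<le> 0}) = A"
    by auto
  ultimately show ?thesis by simp
qed

lemma measure_uminus_image:
  "measure lebesgue (uminus ` A) = measure lebesgue (A :: 'a::euclidean_space set)"
  using measure_lebesgue_affine[of "-1" 0 A] by simp

text \<open>Girard's theorem by inclusion-exclusion: the ball is cut into eight sectors by three planes
  through its centre, and opposite sectors have equal volume.\<close>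

lemma measure_trihedral_sector:
  fixes n1 n2 n3 :: "'a::euclidean_space"
  assumes n: "n1 \<noteq> 0" "n2 \<noteq> 0" "n3 \<noteq> 0"
  defines "H \<equiv> \<lambda>n. {y. 0 \<le> n \<bullet> y}"
  shows "2 * measure lebesgue (cball 0 r \<inter> H n1 \<inter> H n2 \<inter> H n3) =
    measure lebesgue (cball 0 r \<inter> H n1 \<inter> H n2) + measure lebesgue (cball 0 r \<inter> H n1 \<inter> H n3)
    + measure lebesgue (cball 0 r \<inter> H n2 \<inter> H n3) - measure lebesgue (cball (0::'a) r) / 2"
proof -
  define H' :: "'a \<Rightarrow> 'a set" where "H' = (\<lambda>n. {y. n \<bullet> y \<le> 0})"
  let ?m = "measure lebesgue" and ?B = "cball (0::'a) r"
  have cl: "closed (H n)" "closed (H' n)" for n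
    unfolding H_def H'_def by (rule closed_halfspace_ge closed_halfspace_le)+
  have meas: "?B \<inter> C \<in> lmeasurable" if "closed C" for C
    using that by (intro lmeasurable_compact compact_Int_closed compact_cball)
  have split: "?m (?B \<inter> C \<inter> H n) + ?m (?B \<inter> C \<inter> H' n) = ?m (?B \<inter> C)" if "closed C" "n \<noteq> 0" for C n
    unfolding H_def H'_def using measure_Int_halfspace_split[OF meas[OF that(1)] that(2)] .
  have refl: "?m (?B \<inter> H n \<inter> H' u \<inter> H' v) = ?m (?B \<inter> H' n \<inter> H u \<inter> H v)" for n u v
  proof -
    have "uminus ` (?B \<inter> H' n \<inter> H u \<inter> H v) = ?B \<inter> H n \<inter> H' u \<inter> H' v"
    proof safe
      fix y assume "y \<in> ?B" "y \<in> H n" "y \<in> H' u" "y \<in> H' v"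
      then show "y \<in> uminus ` (?B \<inter> H' n \<inter> H u \<inter> H v)"
        by (intro image_eqI[of _ _ "- y"]) (auto simp: H_def H'_def)
    qed (auto simp: H_def H'_def)
    then show ?thesis
      using measure_uminus_image by metis
  qed
  have half: "?m (?B \<inter> H n1) = ?m (?B \<inter> H' n1)"
  proof -
    have "uminus ` (?B \<inter> H' n1) = ?B \<inter> H n1"
    proof safe
      fix y assume "y \<in> ?B" "y \<in> H n1"
      then show "y \<in> uminus ` (?B \<inter> H' n1)"
        by (intro image_eqI[of _ _ "- y"]) (auto simp: H_def H'_def)
    qed (auto simp: H_def H'_def)
    then show ?thesis
      using measure_uminus_image by metis
  qed
  note cls = closed_Int[OF cl(1) cl(1)] closed_Int[OF cl(1) cl(2)] cl
  have e1: "?m (?B \<inter> H n1) + ?m (?B \<inter> H' n1) = ?m ?B"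
    using split[OF closed_UNIV n(1)] by simp
  have e2: "?m (?B \<inter> H n1 \<inter> H n2) + ?m (?B \<inter> H n1 \<inter> H' n2) = ?m (?B \<inter> H n1)"
    using split[OF cl(1) n(2)] .
  have e3: "?m (?B \<inter> H n1 \<inter> H' n2 \<inter> H n3) + ?m (?B \<inter> H n1 \<inter> H' n2 \<inter> H' n3) = ?m (?B \<inter> H n1 \<inter> H' n2)"
    using split[OF cls(2) n(3)] by (simp add: Int_assoc)
  have e4: "?m (?B \<inter> H n1 \<inter> H n3 \<inter> H n2) + ?m (?B \<inter> H n1 \<inter> H n3 \<inter> H' n2) = ?m (?B \<inter> H n1 \<inter> H n3)"
    using split[OF cls(1) n(2)] by (simp add: Int_assoc)
  have e5: "?m (?B \<inter> H n2 \<inter> H n3 \<inter> H n1) + ?m (?B \<inter> H n2 \<inter> H n3 \<inter> H' n1) = ?m (?B \<inter> H n2 \<inter> H n3)"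
    using split[OF cls(1) n(1)] by (simp add: Int_assoc)
  \<comment> \<open>\<open>e4\<close> and \<open>e5\<close> count the wanted sector twice and leave
    the sectors + - + and - + +. By \<open>refl\<close> the latter has the volume of + - -, and
    together they fill the pair region in \<open>e3\<close>, which \<open>e2\<close> evaluates as
    half the ball minus the first pair.\<close>
  show ?thesis
    using e1 e2 e3 e4 e5 half refl[of n1 n2 n3] by (simp add: Int_ac)
qed

text \<open>Orthonormal coordinates along the lines through the midpoints of opposite edges of the
  tetrahedron, so that the edge joining the first two vertices is parallel to the third axis.\<close>

definition chart :: "real ^ 3 \<Rightarrow> real ^ 4" where
  "chart y = (\<chi> i. if i = 1 then (y$1 + sqrt 2 * y$3) / 2 else if i = 2 then (y$1 - sqrt 2 * y$3) / 2
     else if i = 3 then (- y$1 + sqrt 2 * y$2) / 2 else (- y$1 - sqrt 2 * y$2) / 2)"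

lemma chart_nth [simp]:
  "chart y $ 1 = (y$1 + sqrt 2 * y$3) / 2" "chart y $ 2 = (y$1 - sqrt 2 * y$3) / 2"
  "chart y $ 3 = (- y$1 + sqrt 2 * y$2) / 2" "chart y $ 4 = (- y$1 - sqrt 2 * y$2) / 2"
  by (simp_all add: chart_def)

lemma power2_norm_3: "(norm y)\<^sup>2 = (y$1)\<^sup>2 + (y$2)\<^sup>2 + (y$3)\<^sup>2" for y :: "real ^ 3"
  by (simp add: power2_norm_vec sum_3)

lemma ones_perp_isometry_chart: "ones_perp_isometry chart"
  unfolding ones_perp_isometry_def
proof (intro conjI allI)
  show "linear chart"
    by (rule linearI) (simp_all add: vec_eq_iff forall_4 field_simps)
  show "norm (chart y) = norm y" for y
  proof (rule power2_eq_imp_eq)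
    have s: "(sqrt 2 * t)\<^sup>2 = 2 * t\<^sup>2" for t
      by (simp add: power_mult_distrib)
    have "(norm (chart y))\<^sup>2 = ((y$1 + sqrt 2 * y$3)\<^sup>2 + (y$1 - sqrt 2 * y$3)\<^sup>2 + (- y$1 + sqrt 2 * y$2)\<^sup>2 + (- y$1 - sqrt 2 * y$2)\<^sup>2) / 4"
      by (simp only: power2_norm_vec sum_4 chart_nth power_divide) simp
    also have "\<dots> = (4 * (y$1)\<^sup>2 + 2 * (sqrt 2 * y$3)\<^sup>2 + 2 * (sqrt 2 * y$2)\<^sup>2) / 4"
      by (simp add: power2_eq_square algebra_simps)
    also have "\<dots> = (norm y)\<^sup>2"
      unfolding s power2_norm_3 by (simp add: field_simps)
    finally show "(norm (chart y))\<^sup>2 = (norm y)\<^sup>2" .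
  qed simp_all
  show "range chart = ones_perp"
  proof safe
    fix y show "chart y \<in> ones_perp"
      by (simp add: ones_perp_iff sum_4 field_simps)
  next
    fix p assume "p \<in> ones_perp"
    then have p4: "p$4 = - p$1 - p$2 - p$3"
      by (simp add: ones_perp_iff sum_4)
    have "p = chart (vector [p$1 + p$2, (p$3 - p$4) / sqrt 2, (p$1 - p$2) / sqrt 2])"
      by (simp add: vec_eq_iff forall_4 p4 field_simps)
    then show "p \<in> range chart" by blast
  qed
qed

lemmas chart_in_ones_perp = ones_perp_isometry_chart[unfolded ones_perp_isometry_def, THEN conjunct2, THEN conjunct2,
    THEN equalityD1, THEN subsetD, OF rangeI]

lemma linear_chart: "linear chart"
  using ones_perp_isometry_chart by (simp add: ones_perp_isometry_def)

lemma norm_chart: "norm (chart y) = norm y"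
  using ones_perp_isometry_chart by (simp add: ones_perp_isometry_def)

lemma measure_simplex_piece:
  shows "chart -` U3_piece {} \<in> lmeasurable" "measure lebesgue (chart -` U3_piece {}) = 2 * sqrt 2 / 3"
proof -
  \<comment> \<open>\<open>h\<close> sends the unit vectors to the edges of T issuing from its
    fourth vertex, and \<open>c\<close> is that vertex. The coordinates of z are then the first
    three s_i divided by sqrt 2.\<close>
  define h :: "real ^ 3 \<Rightarrow> real ^ 3" where
    "h z = vector [sqrt 2 * (z$1 + z$2), z$1 + z$2 + 2 * z$3, z$1 - z$2]" for z
  define c :: "real ^ 3" where "c = vector [- (sqrt 2 / 2), - 1, 0]"
  define K :: "(real ^ 3) set" where "K = convex hull (insert 0 Basis)"
  have K: "K = {z. 0 \<le> z$1 \<and> 0 \<le> z$2 \<and> 0 \<le> z$3 \<and> z$1 + z$2 + z$3 \<le> 1}"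
  proof -
    have B: "(Basis :: (real ^ 3) set) = (\<lambda>i. axis i 1) ` UNIV"
      by (auto simp: Basis_vec_def)
    have "sum ((\<bullet>) z) Basis = z$1 + z$2 + z$3" for z :: "real ^ 3"
      unfolding B by (subst sum.reindex) (auto simp: inj_on_def axis_eq_axis inner_axis sum_3)
    then show ?thesis
      unfolding K_def std_simplex by (auto simp: B inner_axis forall_3)
  qed
  have linh: "linear h"
    by (rule linearI) (simp_all add: h_def vec_eq_iff forall_3 algebra_simps)
  have "det (matrix h) = 4 * sqrt 2"
    by (simp add: det_3 matrix_def h_def axis_def)
  moreover have Kl: "K \<in> lmeasurable"
    unfolding K_def by (intro lmeasurable_compact finite_imp_compact_convex_hull) simp
  moreover have "measure lebesgue K = 1 / 6"
    using content_std_simplex[where 'a = "real ^ 3"] Kl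
    by (simp add: K_def measure_completion fact_numeral compact_imp_closed finite_imp_compact_convex_hull)
  ultimately have m: "(+) c ` h ` K \<in> lmeasurable" "measure lebesgue ((+) c ` h ` K) = 2 * sqrt 2 / 3"
    using measurable_linear_image[OF linh Kl] measure_linear_image[OF linh Kl]
    by (simp_all add: measurable_translation measure_translation)
  have "chart -` U3_piece {} = (+) c ` h ` K"
  proof (intro equalityI subsetI)
    fix y assume "y \<in> chart -` U3_piece {}"
    then have nn: "0 \<le> shifted (chart y) i" for i
      by (auto simp: U3_piece_iff not_less)
    define z :: "real ^ 3" where "z = vector [shifted (chart y) 1 / sqrt 2, shifted (chart y) 2 / sqrt 2, shifted (chart y) 3 / sqrt 2]"
    have "z \<in> K"
    proof -
      have "shifted (chart y) 1 + shifted (chart y) 2 + shifted (chart y) 3 \<le> sqrt 2"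
        using sum_shifted[OF chart_in_ones_perp[of y]] nn[of 4] by (simp add: sum_4)
      then have "(shifted (chart y) 1 + shifted (chart y) 2 + shifted (chart y) 3) / sqrt 2 \<le> 1"
        by simp
      then show ?thesis
        using nn by (simp add: K z_def add_divide_distrib)
    qed
    moreover have "y = c + h z"
      by (simp add: vec_eq_iff forall_3 c_def h_def z_def shifted_def field_simps)
    ultimately show "y \<in> (+) c ` h ` K" by blast
  next
    fix y assume "y \<in> (+) c ` h ` K"
    then obtain z where z: "z \<in> K" and y: "y = c + h z"
      by blast
    have s: "shifted (chart (c + h z)) 1 = sqrt 2 * z$1" "shifted (chart (c + h z)) 2 = sqrt 2 * z$2"
      "shifted (chart (c + h z)) 3 = sqrt 2 * z$3" "shifted (chart (c + h z)) 4 = sqrt 2 * (1 - z$1 - z$2 - z$3)"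
      by (simp_all add: c_def h_def shifted_def field_simps)
    have nn: "0 \<le> shifted (chart (c + h z)) i" for i
      using exhaust_4[of i] z by (auto simp: s K)
    then have "{i. shifted (chart (c + h z)) i < 0} = {}"
      by (simp add: not_less)
    then show "y \<in> chart -` U3_piece {}"
      unfolding y using U3_simplex[OF chart_in_ones_perp nn] by (simp add: U3_piece_iff)
  qed
  with m show "chart -` U3_piece {} \<in> lmeasurable" "measure lebesgue (chart -` U3_piece {}) = 2 * sqrt 2 / 3"
    by simp_all
qed

section \<open>Wedges of the ball and the cone at a vertex\<close>

lemma lune_image:
  "ell_cyl 1 0 1 0 ` {y. 0 < y$1 \<and> \<bar>y$2\<bar> < arctan (1 / sqrt 2) \<and> (y$3)\<^sup>2 \<le> 4 - (y$1)\<^sup>2}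
    = {z. norm z \<le> 2 \<and> sqrt 2 * \<bar>z$2\<bar> < z$1}" (is "?L = ?R")
proof safe
  have ub: "arctan (1 / sqrt 2) < pi / 2"
    by (rule arctan_ubound)
  have n: "norm z \<le> 2 \<longleftrightarrow> (z$3)\<^sup>2 \<le> 4 - ((z$1)\<^sup>2 + (z$2)\<^sup>2)" for z :: "real ^ 3"
    using power2_norm_3[of z] power_mono_iff[of "norm z" 2 2] by auto
  {
    fix y :: "real ^ 3"
    assume y: "0 < y$1" "\<bar>y$2\<bar> < arctan (1 / sqrt 2)" "(y$3)\<^sup>2 \<le> 4 - (y$1)\<^sup>2"
    have "(y$1 * cos (y$2))\<^sup>2 + (y$1 * sin (y$2))\<^sup>2 = (y$1)\<^sup>2"
      by (simp add: power_mult_distrib flip: distrib_left)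
    then show "norm (ell_cyl 1 0 1 0 y) \<le> 2"
      using y(3) by (simp add: n ell_cyl_def)
    have c: "0 < cos \<bar>y$2\<bar>"
      using y(2) ub by (intro cos_gt_zero_pi) auto
    have "tan \<bar>y$2\<bar> < tan (arctan (1 / sqrt 2))"
      using y(2) ub by (intro tan_monotone) auto
    then have "sin \<bar>y$2\<bar> / cos \<bar>y$2\<bar> < 1 / sqrt 2"
      unfolding tan_arctan by (simp add: tan_def)
    then have "sqrt 2 * sin \<bar>y$2\<bar> < cos \<bar>y$2\<bar>"
      using c by (simp add: field_simps)
    moreover have "0 \<le> sin \<bar>y$2\<bar>"
      using y(2) ub by (intro sin_ge_zero) auto
    moreover have "\<bar>sin (y$2)\<bar> = \<bar>sin \<bar>y$2\<bar>\<bar>" "cos \<bar>y$2\<bar> = cos (y$2)"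
      by (auto simp: abs_if)
    ultimately have "sqrt 2 * \<bar>sin (y$2)\<bar> < cos (y$2)"
      by simp
    then have "y$1 * (sqrt 2 * \<bar>sin (y$2)\<bar>) < y$1 * cos (y$2)"
      using y(1) by simp
    then show "sqrt 2 * \<bar>ell_cyl 1 0 1 0 y $ 2\<bar> < ell_cyl 1 0 1 0 y $ 1"
      using y(1) by (simp add: ell_cyl_def abs_mult mult.left_commute)
  }
  fix z :: "real ^ 3"
  assume z: "norm z \<le> 2" "sqrt 2 * \<bar>z$2\<bar> < z$1"
  have z1: "0 < z$1"
    using z(2) by (rule le_less_trans[rotated]) simp
  define r where "r = sqrt ((z$1)\<^sup>2 + (z$2)\<^sup>2)"
  define q where "q = arctan (z$2 / z$1)"
  have r: "0 < r" "r\<^sup>2 = (z$1)\<^sup>2 + (z$2)\<^sup>2"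
    using z1 by (auto simp: r_def intro!: add_pos_nonneg)
  have "1 + (z$2 / z$1)\<^sup>2 = (r / z$1)\<^sup>2"
    using z1 by (simp add: power_divide r(2) field_simps)
  then have s: "sqrt (1 + (z$2 / z$1)\<^sup>2) = r / z$1"
    using z1 r(1) by simp
  have "cos q = z$1 / r" "sin q = z$2 / r"
    using z1 r(1) unfolding q_def cos_arctan sin_arctan s by (auto simp: field_simps)
  then have "z = ell_cyl 1 0 1 0 (vector [r, q, z$3])"
    using r(1) by (simp add: vec_eq_iff forall_3 ell_cyl_def)
  moreover have "\<bar>q\<bar> < arctan (1 / sqrt 2)"
  proof -
    have "\<bar>z$2\<bar> / z$1 < 1 / sqrt 2"
      using z(2) z1 by (simp add: field_simps)
    then have "\<bar>z$2 / z$1\<bar> < 1 / sqrt 2"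
      using z1 by simp
    then have "z$2 / z$1 < 1 / sqrt 2" "- (z$2 / z$1) < 1 / sqrt 2"
      unfolding abs_less_iff by blast+
    then have "arctan (z$2 / z$1) < arctan (1 / sqrt 2)" "arctan (- (z$2 / z$1)) < arctan (1 / sqrt 2)"
      by (simp_all only: arctan_less_iff)
    then show ?thesis
      unfolding q_def abs_less_iff arctan_minus by blast
  qed
  moreover have "(z$3)\<^sup>2 \<le> 4 - r\<^sup>2"
    using z(1) by (simp add: n r(2))
  ultimately show "z \<in> ?L"
    using r(1) by (intro image_eqI[of _ _ "vector [r, q, z$3]"]) auto
qed

lemma negligible_halfplane_boundary:
  fixes a b :: real
  assumes "b \<noteq> 0"
  shows "negligible {z :: real ^ 3. a * \<bar>z$2\<bar> = b * z$1}"
proof -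
  have "negligible {z :: real ^ 3. vector [b, c, 0] \<bullet> z = 0}" for c
    using assms by (intro negligible_hyperplane) (auto simp: vec_eq_iff forall_3)
  then have "negligible ({z :: real ^ 3. vector [b, - a, 0] \<bullet> z = 0} \<union> {z. vector [b, a, 0] \<bullet> z = 0})"
    by simp
  then show ?thesis
    by (rule negligible_subset) (auto simp: inner_vec_def sum_3 abs_if split: if_splits)
qed

lemma measure_wedge:
  "{z :: real ^ 3. norm z \<le> 2 \<and> sqrt 2 * \<bar>z$2\<bar> \<le> z$1} \<in> lmeasurable" (is "?W \<in> _")
  "measure lebesgue {z :: real ^ 3. norm z \<le> 2 \<and> sqrt 2 * \<bar>z$2\<bar> \<le> z$1} = 32 / 3 * arctan (1 / sqrt 2)"
proof -
  let ?R = "{z :: real ^ 3. norm z \<le> 2 \<and> sqrt 2 * \<bar>z$2\<bar> < z$1}"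
  have R: "?R \<in> lmeasurable" "measure lebesgue ?R = 32 / 3 * arctan (1 / sqrt 2)"
    using measure_lune unfolding lune_image by blast+
  have neg: "negligible (?R - ?W \<union> (?W - ?R))"
    by (rule negligible_subset[OF negligible_halfplane_boundary[of 1 "sqrt 2"]]) auto
  show "?W \<in> lmeasurable"
    by (rule lmeasurable_negligible_symdiff[OF R(1) neg])
  show "measure lebesgue ?W = 32 / 3 * arctan (1 / sqrt 2)"
    unfolding R(2)[symmetric] by (rule measure_negligible_symdiff[OF R(1) neg])
qed

text \<open>Each pair of facet planes bounds a wedge with the dihedral angle of T. For the indices 3
  and 4 it is the reflected \<open>measure_wedge\<close>; a permutation with 3 to i and 4 to j gives
  the other pairs.\<close>

lemma measure_cone_pair:
  fixes i j :: 4
  assumes ij: "i \<noteq> j"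
  shows "measure lebesgue (cball 0 2 \<inter> {z. 0 \<le> chart z $ i} \<inter> {z. 0 \<le> chart z $ j}) = 32 / 3 * arctan (1 / sqrt 2)"
proof -
  define X :: "4 \<Rightarrow> 4 \<Rightarrow> (real ^ 4) set" where "X i j = {p. norm p \<le> 2 \<and> 0 \<le> p$i \<and> 0 \<le> p$j}" for i j
  have X: "chart -` X i j = cball 0 2 \<inter> {z. 0 \<le> chart z $ i} \<inter> {z. 0 \<le> chart z $ j}" for i j
    by (auto simp: X_def norm_chart)
  have abs: "sqrt 2 * \<bar>b\<bar> \<le> a \<longleftrightarrow> sqrt 2 * b \<le> a \<and> - (sqrt 2 * b) \<le> a" for a b :: real
  proof -
    have "sqrt 2 * \<bar>b\<bar> = \<bar>sqrt 2 * b\<bar>"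
      by (simp add: abs_mult)
    then show ?thesis
      unfolding abs_le_iff[symmetric] by simp
  qed
  have "chart -` X 3 4 = uminus ` {z. norm z \<le> 2 \<and> sqrt 2 * \<bar>z$2\<bar> \<le> z$1}"
  proof (intro equalityI subsetI)
    fix z assume "z \<in> chart -` X 3 4"
    then show "z \<in> uminus ` {z. norm z \<le> 2 \<and> sqrt 2 * \<bar>z$2\<bar> \<le> z$1}"
      by (intro image_eqI[of _ _ "- z"]) (auto simp: X_def norm_chart abs)
  qed (auto simp: X_def norm_chart abs)
  then have 34: "measure lebesgue (chart -` X 3 4) = 32 / 3 * arctan (1 / sqrt 2)"
    by (simp only: measure_uminus_image measure_wedge(2))
  have meas: "chart -` X i j \<in> lmeasurable" for i j
  proof -
    have "closed {z. 0 \<le> chart z $ i}" for i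
      by (intro closed_Collect_le continuous_intros linear_continuous_on_compose[OF _ linear_chart])
    then show ?thesis
      unfolding X by (intro lmeasurable_compact compact_Int_closed compact_cball) auto
  qed
  obtain h :: "4 \<Rightarrow> 4" where h: "bij_betw h {3, 4} {i, j}" "h 3 = i" "h 4 = j"
    using ij by (intro that[of "\<lambda>k. if k = 3 then i else j"]) (auto simp: bij_betw_def inj_on_def)
  from bij_betw_extend_finite[OF h(1)] obtain \<pi>
    where \<pi>: "bij \<pi>" "\<And>k. k \<in> {3, 4} \<Longrightarrow> \<pi> k = h k"
    by blast
  have "\<pi> 3 = i" "\<pi> 4 = j"
    using \<pi>(2) h(2,3) by simp_all
  then have "permute_vec \<pi> -` X 3 4 = X i j"
    using norm_permute_vec[OF \<pi>(1)] by (auto simp: X_def) (simp_all add: permute_vec_def)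
  then show ?thesis
    using measure_vimage_permute(2)[OF ones_perp_isometry_chart \<pi>(1) meas, of 3 4] 34 by (simp add: X)
qed

lemma measure_sector:
  defines "Sec \<equiv> {y. (\<forall>i. i \<noteq> 1 \<longrightarrow> 0 \<le> shifted (chart y) i) \<and>
    (\<Sum>i\<in>UNIV. (shifted (chart y) i)\<^sup>2) \<le> 2 + 2 * sqrt 2 * shifted (chart y) 1}"
  shows "Sec \<in> lmeasurable" "measure lebesgue Sec = 16 * arctan (1 / sqrt 2) - 8 * pi / 3"
proof -
  define n :: "4 \<Rightarrow> real ^ 3" where "n i = (if i = 2 then vector [1/2, 0, - (sqrt 2 / 2)]
    else if i = 3 then vector [- (1/2), sqrt 2 / 2, 0] else vector [- (1/2), - (sqrt 2 / 2), 0])" for i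
  have n: "n i \<bullet> z = chart z $ i" "n i \<noteq> 0" if "i \<noteq> 1" for i z
    using that exhaust_4[of i] by (auto simp: n_def inner_vec_def sum_3 vec_eq_iff forall_3 field_simps)
  define K where "K = cball 0 2 \<inter> {z. 0 \<le> n 2 \<bullet> z} \<inter> {z. 0 \<le> n 3 \<bullet> z} \<inter> {z. 0 \<le> n 4 \<bullet> z}"
  have "K \<in> lmeasurable"
    unfolding K_def by (intro lmeasurable_compact compact_Int_closed compact_cball closed_halfspace_ge)
  moreover have "measure lebesgue (cball (0 :: real ^ 3) 2) = 32 / 3 * pi"
    by (simp add: measure_completion content_cball eval_unit_ball_vol)
  then have "2 * measure lebesgue K = 3 * (32 / 3 * arctan (1 / sqrt 2)) - 16 / 3 * pi"
    using measure_trihedral_sector[of "n 2" "n 3" "n 4" 2] measure_cone_pair[of 2 3] measure_cone_pair[of 2 4]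
      measure_cone_pair[of 3 4] unfolding K_def by (simp add: n)
  \<comment> \<open>\<open>c\<close> is the first vertex of T, with s = (sqrt 2, 0, 0, 0). Moving it
    to the origin turns the quadratic condition into |z| at most 2 and the sign conditions into the
    three half-spaces of the cone.\<close>
  moreover define c :: "real ^ 3" where "c = vector [sqrt 2 / 2, 0, 1]"
  have "Sec = (+) c ` K"
  proof -
    have s: "shifted (chart (c + z)) 1 = sqrt 2 + chart z $ 1" "shifted (chart (c + z)) 2 = chart z $ 2"
      "shifted (chart (c + z)) 3 = chart z $ 3" "shifted (chart (c + z)) 4 = chart z $ 4" for z
      by (simp_all add: c_def shifted_def field_simps)
    have sq: "(\<Sum>i\<in>UNIV. (shifted (chart (c + z)) i)\<^sup>2) = 2 + 2 * sqrt 2 * chart z $ 1 + (norm z)\<^sup>2" for z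
    proof -
      have "(norm z)\<^sup>2 = (chart z $ 1)\<^sup>2 + (chart z $ 2)\<^sup>2 + (chart z $ 3)\<^sup>2 + (chart z $ 4)\<^sup>2"
        unfolding norm_chart[symmetric] power2_norm_vec sum_4 ..
      moreover have "(\<Sum>i\<in>UNIV. (shifted (chart (c + z)) i)\<^sup>2) =
          (sqrt 2 + chart z $ 1)\<^sup>2 + (chart z $ 2)\<^sup>2 + (chart z $ 3)\<^sup>2 + (chart z $ 4)\<^sup>2"
        unfolding sum_4 s ..
      moreover have "(sqrt 2 + chart z $ 1)\<^sup>2 = 2 + 2 * sqrt 2 * chart z $ 1 + (chart z $ 1)\<^sup>2"
        unfolding power2_sum by simp
      ultimately show ?thesis by linarith
    qed
    have "c + z \<in> Sec \<longleftrightarrow> z \<in> K" for z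
    proof -
      have "(\<Sum>i\<in>UNIV. (shifted (chart (c + z)) i)\<^sup>2) \<le> 2 + 2 * sqrt 2 * shifted (chart (c + z)) 1 \<longleftrightarrow> (norm z)\<^sup>2 \<le> 2\<^sup>2"
        unfolding sq s by (simp only: distrib_left) (simp add: algebra_simps)
      also have "\<dots> \<longleftrightarrow> norm z \<le> 2"
        by (rule power_mono_iff) auto
      finally have "(\<Sum>i\<in>UNIV. (shifted (chart (c + z)) i)\<^sup>2) \<le> 2 + 2 * sqrt 2 * shifted (chart (c + z)) 1 \<longleftrightarrow> norm z \<le> 2" .
      moreover have "(\<forall>i. i \<noteq> 1 \<longrightarrow> 0 \<le> shifted (chart (c + z)) i) \<longleftrightarrow>
          0 \<le> n 2 \<bullet> z \<and> 0 \<le> n 3 \<bullet> z \<and> 0 \<le> n 4 \<bullet> z"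
        unfolding forall_4 s by (simp add: n del: chart_nth)
      ultimately show ?thesis
        unfolding Sec_def K_def by auto
    qed
    note mem = this
    show ?thesis
    proof (intro equalityI subsetI)
      fix y assume "y \<in> Sec"
      then show "y \<in> (+) c ` K"
        using mem[of "y - c"] by (intro image_eqI[of _ _ "y - c"]) simp_all
    qed (use mem in auto)
  qed
  ultimately show "Sec \<in> lmeasurable" "measure lebesgue Sec = 16 * arctan (1 / sqrt 2) - 8 * pi / 3"
    by (simp_all add: measurable_translation measure_translation)
qed

text \<open>T satisfies the ball condition of every vertex and hence lies inside the sector. What
  the sector has beyond T is exactly the part with a negative first coordinate.\<close>

lemma measure_vertex_piece:
  shows "chart -` U3_piece {1} \<in> lmeasurable"
    "measure lebesgue (chart -` U3_piece {1}) = 16 * arctan (1 / sqrt 2) - 8 * pi / 3 - 2 * sqrt 2 / 3"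
proof -
  define Sec where "Sec = {y. (\<forall>i. i \<noteq> 1 \<longrightarrow> 0 \<le> shifted (chart y) i) \<and>
    (\<Sum>i\<in>UNIV. (shifted (chart y) i)\<^sup>2) \<le> 2 + 2 * sqrt 2 * shifted (chart y) 1}"
  note S = measure_sector[folded Sec_def]
  have sub: "chart -` U3_piece {} \<subseteq> Sec"
  proof
    fix y assume "y \<in> chart -` U3_piece {}"
    then have "chart y \<in> U3" "0 \<le> shifted (chart y) i" for i
      by (auto simp: U3_piece_iff not_less)
    then show "y \<in> Sec"
      unfolding Sec_def using U3_vertex_ball[of "chart y" 1] by auto
  qed
  have "chart -` U3_piece {1} = Sec - chart -` U3_piece {}"
  proof (intro equalityI subsetI)
    fix y assume "y \<in> chart -` U3_piece {1}"
    then have y: "chart y \<in> U3" "{i. shifted (chart y) i < 0} = {1}"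
      by (auto simp: U3_piece_iff)
    then show "y \<in> Sec - chart -` U3_piece {}"
      unfolding Sec_def using U3_vertex_ball[of "chart y" 1] by (auto simp: U3_piece_iff set_eq_iff not_less[symmetric])
  next
    fix y assume y: "y \<in> Sec - chart -` U3_piece {}"
    then have nn: "\<And>i. i \<noteq> 1 \<Longrightarrow> 0 \<le> shifted (chart y) i"
      and ball: "(\<Sum>i\<in>UNIV. (shifted (chart y) i)\<^sup>2) \<le> 2 + 2 * sqrt 2 * shifted (chart y) 1"
      by (auto simp: Sec_def)
    have neg: "shifted (chart y) 1 < 0"
    proof (rule ccontr)
      assume "\<not> shifted (chart y) 1 < 0"
      then have "0 \<le> shifted (chart y) i" for i
        using nn by (cases "i = 1") auto
      then have "chart y \<in> U3_piece {}"
        using U3_simplex[OF chart_in_ones_perp] by (simp add: U3_piece_iff not_less)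
      then show False using y by simp
    qed
    have "{i. shifted (chart y) i < 0} = {1}"
      using neg nn by (auto simp: not_less[symmetric])
    then show "y \<in> chart -` U3_piece {1}"
      using U3_vertex[OF chart_in_ones_perp neg nn ball] by (simp add: U3_piece_iff)
  qed
  then show "chart -` U3_piece {1} \<in> lmeasurable"
    "measure lebesgue (chart -` U3_piece {1}) = 16 * arctan (1 / sqrt 2) - 8 * pi / 3 - 2 * sqrt 2 / 3"
    using S measure_simplex_piece sub
    by (simp_all add: fmeasurable.Diff measurable_measure_Diff fmeasurableD)
qed

subsection \<open>The edge regions and the volume formula\<close>

text \<open>An explicit pair works: w has length r - sqrt 2 and direction q in the plane of the last
  two axes, v lies in the plane of the first two, and |v|^2 + r^2 at most 4 is the height
  condition.\<close>

lemma edge_chart_mem: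
  fixes y :: "real ^ 3"
  assumes R: "sqrt 2 < y$1" and q: "\<bar>y$2\<bar> < pi / 4" and h: "(y$3)\<^sup>2 \<le> 4 - (1 + (cos (y$2))\<^sup>2) * (y$1)\<^sup>2"
  shows "chart (ell_cyl (sqrt 2) 1 1 (sqrt 2) y) \<in> U3_piece {3, 4}"
proof -
  define r \<alpha> c s where "r = y$1" and "\<alpha> = y$3" and "c = cos (y$2)" and "s = sin (y$2)"
  have cs: "c\<^sup>2 + s\<^sup>2 = 1"
    by (simp add: c_def s_def)
  have "cos (pi / 4) < cos \<bar>y$2\<bar>"
    using q by (intro cos_monotone_0_pi) auto
  then have c: "sqrt 2 / 2 < c"
    by (simp add: c_def cos_45)
  then have c0: "0 < c"
    by (rule less_trans[rotated]) simp
  have "(sqrt 2 / 2)\<^sup>2 < c\<^sup>2"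
    using c by (intro power_strict_mono) auto
  then have c2: "1 / 2 < c\<^sup>2"
    by (simp add: power_divide)
  then have "s\<^sup>2 < c\<^sup>2"
    using cs by linarith
  then have sc: "\<bar>s\<bar> < c"
    using c0 by (metis abs_of_pos power2_less_imp_less power2_abs abs_ge_zero less_imp_le)
  have r: "sqrt 2 < r" "0 < r"
    using R less_trans[of 0 "sqrt 2" r] by (simp_all add: r_def)
  then have r2: "2 < r\<^sup>2"
    using power_strict_mono[of "sqrt 2" r 2] by simp
  have h': "\<alpha>\<^sup>2 \<le> 4 - (1 + c\<^sup>2) * r\<^sup>2"
    using h by (simp add: r_def \<alpha>_def c_def)
  \<comment> \<open>This converts the height bound into |\<alpha>| at most r c, which is precisely
    the non-negativity of \<open>v\<close>.\<close>
  have "4 \<le> (1 + 2 * c\<^sup>2) * r\<^sup>2"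
    using mult_mono[of 2 "1 + 2 * c\<^sup>2" 2 "r\<^sup>2"] c2 r2 by simp
  then have "\<alpha>\<^sup>2 \<le> (r * c)\<^sup>2"
    using h' by (simp add: algebra_simps)
  then have \<alpha>: "\<bar>\<alpha>\<bar> \<le> r * c"
    using r(2) c0 by (simp add: abs_le_square_iff[symmetric])
  define v :: "real ^ 4" where "v = (\<chi> i. if i = 1 then (r * c + \<alpha>) / sqrt 2 else if i = 2 then (r * c - \<alpha>) / sqrt 2 else 0)"
  define w :: "real ^ 4" where "w = (\<chi> i. if i = 3 then (r - sqrt 2) * (c - s) / sqrt 2
      else if i = 4 then (r - sqrt 2) * (c + s) / sqrt 2 else 0)"
  have w_pos: "0 < w $ 3" "0 < w $ 4"
    using r(1) sc by (auto simp: w_def abs_less_iff)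
  have "v \<in> nonneg_orthant" "w \<in> nonneg_orthant"
    using \<alpha> w_pos by (auto simp: nonneg_orthant_def forall_4 v_def abs_le_iff) (simp_all add: w_def)
  moreover have "norm w = r - sqrt 2"
  proof (rule power2_eq_imp_eq)
    have "(w $ 3)\<^sup>2 = (r - sqrt 2)\<^sup>2 * (c - s)\<^sup>2 / 2" "(w $ 4)\<^sup>2 = (r - sqrt 2)\<^sup>2 * (c + s)\<^sup>2 / 2"
      by (simp_all add: w_def power_divide power_mult_distrib)
    moreover have "w $ 1 = 0" "w $ 2 = 0"
      by (simp_all add: w_def)
    ultimately have "(norm w)\<^sup>2 = (r - sqrt 2)\<^sup>2 * ((c - s)\<^sup>2 + (c + s)\<^sup>2) / 2"
      by (simp add: power2_norm_vec sum_4 distrib_left add_divide_distrib)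
    also have "(c - s)\<^sup>2 + (c + s)\<^sup>2 = 2 * (c\<^sup>2 + s\<^sup>2)"
      by (simp add: power2_eq_square algebra_simps)
    finally show "(norm w)\<^sup>2 = (r - sqrt 2)\<^sup>2"
      by (simp add: cs)
  qed (use r in auto)
  moreover have "(norm v)\<^sup>2 = (r * c)\<^sup>2 + \<alpha>\<^sup>2"
  proof -
    have "(norm v)\<^sup>2 = ((r * c + \<alpha>)\<^sup>2 + (r * c - \<alpha>)\<^sup>2) / 2"
      by (simp add: power2_norm_vec sum_4 v_def power_divide)
    then show ?thesis
      by (simp add: power2_eq_square algebra_simps)
  qed
  ultimately have "v - w \<in> M4"
    unfolding M4_def mem_Collect_eq using h'
    by (intro exI[of _ v] exI[of _ w]) (simp add: power_mult_distrib algebra_simps)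
  moreover define p where "p = chart (ell_cyl (sqrt 2) 1 1 (sqrt 2) y)"
  \<comment> \<open>\<open>c / 2\<close> is the stationary lift for the direction q.\<close>
  have pvw: "p + vec (c / 2) = v - w"
    by (simp add: vec_eq_iff forall_4 p_def ell_cyl_def v_def w_def flip: r_def \<alpha>_def c_def s_def)
      (simp add: field_simps)
  ultimately have p: "p \<in> U3"
    unfolding U3_iff p_def using chart_in_ones_perp by metis
  have "p $ i + c / 2 = v $ i - w $ i" for i
    using arg_cong[OF pvw, of "\<lambda>x. x $ i"] by simp
  from this[of 3] this[of 4] have "shifted p 3 < 0" "shifted p 4 < 0"
    using w_pos c by (simp_all add: shifted_def v_def)
  then have sub: "{3, 4} \<subseteq> {i. shifted p i < 0}"
    by simp
  \<comment> \<open>Coordinates 3 and 4 are negative since c / 2 exceeds sqrt 2 / 4. A further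
    negative coordinate would place p in a piece already known to be empty, so the first two need no
    estimate.\<close>
  have "{i. shifted p i < 0} = {3, 4}"
  proof (rule ccontr)
    assume "{i. shifted p i < 0} \<noteq> {3, 4}"
    then have "card {3, 4 :: 4} < card {i. shifted p i < 0}"
      using sub by (intro psubset_card_mono) auto
    then have "U3_piece {i. shifted p i < 0} = {}"
      by (intro U3_piece_empty) simp
    then show False
      using p U3_piece_iff by blast
  qed
  then show ?thesis
    using p by (simp add: U3_piece_iff p_def)
qed

text \<open>The two negative coordinates suffice to find r and q and to confine q. Membership in
  \<open>U3\<close> enters only through the one ball with direction q, which yields the height
  bound.\<close>

lemma edge_chart_image:
  fixes y :: "real ^ 3"
  assumes y: "chart y \<in> U3_piece {3, 4}" and y2: "y$2 \<noteq> 0"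
  shows "y \<in> ell_cyl (sqrt 2) 1 1 (sqrt 2) `
    {y. sqrt 2 < y$1 \<and> \<bar>y$2\<bar> < pi / 4 \<and> (y$3)\<^sup>2 \<le> 4 - (1 + (cos (y$2))\<^sup>2) * (y$1)\<^sup>2}"
proof -
  define x b where "x = y$1" and "b = y$2"
  have p: "chart y \<in> U3" and "shifted (chart y) 3 < 0" "shifted (chart y) 4 < 0"
    using y by (auto simp: U3_piece_iff set_eq_iff)
  then have "x - sqrt 2 * b > sqrt 2 / 2" "x + sqrt 2 * b > sqrt 2 / 2"
    by (simp_all add: shifted_def x_def b_def field_simps)
  then have x: "sqrt 2 / 2 < x - sqrt 2 * \<bar>b\<bar>"
    by (simp add: abs_if)
  then have x0: "0 < x"
    using mult_nonneg_nonneg[of "sqrt 2" "\<bar>b\<bar>"] real_sqrt_gt_zero[of 2] by linarith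
  have b: "b \<noteq> 0"
    using y2 by (simp add: b_def)
  \<comment> \<open>\<open>E r = 1\<close> puts (x, b) on the ellipse with semi-axes sqrt 2 r - 1
    and r - sqrt 2. At r = sqrt 2 + |b| the second term alone is 1; at sqrt 2 + |b| + x both
    denominators are at least |b| + x, so the sum is at most 1. Since b is nonzero, the whole
    interval lies to the right of the pole at sqrt 2.\<close>
  define E where "E = (\<lambda>r. (x / (sqrt 2 * r - 1))\<^sup>2 + (b / (r - sqrt 2))\<^sup>2)"
  have den: "1 < sqrt 2 * r - 1" "0 < r - sqrt 2" if "sqrt 2 < r" for r
  proof -
    have "sqrt 2 * sqrt 2 < sqrt 2 * r"
      using that by (intro mult_strict_left_mono) auto
    then show "1 < sqrt 2 * r - 1" by simp
  qed (use that in simp)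
  have "\<exists>r. sqrt 2 + \<bar>b\<bar> \<le> r \<and> r \<le> sqrt 2 + \<bar>b\<bar> + x \<and> E r = 1"
  proof (rule IVT2')
    have "0 \<le> (x / (sqrt 2 * (sqrt 2 + \<bar>b\<bar>) - 1))\<^sup>2"
      by simp
    then show "1 \<le> E (sqrt 2 + \<bar>b\<bar>)"
      using b by (simp add: E_def power_divide)
    define m where "m = \<bar>b\<bar> + x"
    have m: "0 < m" using x0 by (simp add: m_def)
    have "(x / (sqrt 2 * (sqrt 2 + \<bar>b\<bar> + x) - 1))\<^sup>2 \<le> (x / m)\<^sup>2"
    proof (intro power_mono divide_left_mono)
      have "m \<le> sqrt 2 * m"
        using m by simp
      then show le: "m \<le> sqrt 2 * (sqrt 2 + \<bar>b\<bar> + x) - 1"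
        by (simp add: m_def algebra_simps)
      then show "0 < (sqrt 2 * (sqrt 2 + \<bar>b\<bar> + x) - 1) * m"
        using m by simp
      show "0 \<le> x / (sqrt 2 * (sqrt 2 + \<bar>b\<bar> + x) - 1)"
        using x0 m le by simp
    qed (use x0 in auto)
    moreover have "(x / m)\<^sup>2 + (b / m)\<^sup>2 \<le> 1"
    proof -
      have "x\<^sup>2 + b\<^sup>2 \<le> m\<^sup>2"
        using x0 unfolding m_def power2_sum by simp
      then show ?thesis
        using m by (simp add: power_divide flip: add_divide_distrib)
    qed
    ultimately show "E (sqrt 2 + \<bar>b\<bar> + x) \<le> 1"
      by (simp add: E_def m_def add.assoc)
    have "sqrt 2 * r - 1 \<noteq> 0" "r - sqrt 2 \<noteq> 0" if "r \<in> {sqrt 2 + \<bar>b\<bar>..sqrt 2 + \<bar>b\<bar> + x}" for r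
    proof -
      have "sqrt 2 < r" using that b by auto
      from den[OF this] show "sqrt 2 * r - 1 \<noteq> 0" "r - sqrt 2 \<noteq> 0" by linarith+
    qed
    then show "continuous_on {sqrt 2 + \<bar>b\<bar>..sqrt 2 + \<bar>b\<bar> + x} E"
      unfolding E_def by (intro continuous_on_add continuous_on_power continuous_on_divide
          continuous_on_diff continuous_on_mult continuous_on_const continuous_on_id) auto
  qed (use x0 in simp)
  then obtain r where r: "sqrt 2 < r" and Er: "E r = 1"
    using b by force
  define c s where "c = x / (sqrt 2 * r - 1)" and "s = b / (r - sqrt 2)"
  have cs: "c\<^sup>2 + s\<^sup>2 = 1"
    using Er by (simp add: E_def c_def s_def)
  have c0: "0 < c"
    using x0 den(1)[OF r] by (simp add: c_def)
  have xb: "x = (sqrt 2 * r - 1) * c" "b = (r - sqrt 2) * s"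
    using den[OF r] by (simp_all add: c_def s_def)
  \<comment> \<open>Otherwise sqrt 2 r > 2 and c - |s| at most 0 bound x - sqrt 2 |b| by c. Then c
    exceeds sqrt 2 / 2, and so does |s|, against c^2 + s^2 = 1.\<close>
  have sc: "\<bar>s\<bar> < c"
  proof (rule ccontr)
    assume "\<not> \<bar>s\<bar> < c"
    then have le: "c \<le> \<bar>s\<bar>" by simp
    have abs_b: "\<bar>b\<bar> = (r - sqrt 2) * \<bar>s\<bar>"
      using r by (simp add: xb(2) abs_mult)
    have "x - sqrt 2 * \<bar>b\<bar> = sqrt 2 * r * (c - \<bar>s\<bar>) - c + 2 * \<bar>s\<bar>"
      unfolding abs_b xb(1) by (simp add: algebra_simps)
    also have "\<dots> \<le> 2 * (c - \<bar>s\<bar>) - c + 2 * \<bar>s\<bar>"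
      using mult_right_mono_neg[of 2 "sqrt 2 * r" "c - \<bar>s\<bar>"] den(1)[OF r] le by simp
    finally have "sqrt 2 / 2 < c"
      using x by simp
    then have "(sqrt 2 / 2)\<^sup>2 < c\<^sup>2"
      by (intro power_strict_mono) auto
    moreover have "c\<^sup>2 \<le> s\<^sup>2"
      using le c0 by (simp add: abs_le_square_iff[symmetric])
    ultimately show False
      using cs by (simp add: power_divide)
  qed
  define q where "q = arcsin s"
  have "\<bar>s\<bar> \<le> 1"
    using cs by (simp add: abs_square_le_1[symmetric]) (smt (verit) zero_le_power2)
  then have s1: "- 1 \<le> s" "s \<le> 1" by (simp_all add: abs_le_iff)
  have q_sc: "sin q = s" "cos q = c"
  proof -
    show "sin q = s" using s1 by (simp add: q_def)
    have "1 - s\<^sup>2 = c\<^sup>2" using cs by simp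
    then show "cos q = c"
      using s1 c0 by (simp add: q_def cos_arcsin)
  qed
  have "\<bar>q\<bar> < pi / 4"
  proof -
    have "s\<^sup>2 < c\<^sup>2"
      using power_strict_mono[of "\<bar>s\<bar>" c 2] sc by simp
    then have "s\<^sup>2 < (sqrt 2 / 2)\<^sup>2"
      using cs by (simp add: power_divide)
    then have "\<bar>s\<bar> < sqrt 2 / 2"
      using power2_less_imp_less[of "\<bar>s\<bar>" "sqrt 2 / 2"] by simp
    then have "\<bar>s\<bar> < sin (pi / 4)"
      by (simp add: sin_45)
    then have "arcsin s < arcsin (sin (pi / 4))" "arcsin (- sin (pi / 4)) < arcsin s"
      using s1 by (auto intro!: arcsin_less_arcsin simp: abs_less_iff)
    moreover have "arcsin (sin (pi / 4)) = pi / 4"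
      by (rule arcsin_sin) auto
    moreover have "arcsin (- sin (pi / 4)) = - arcsin (sin (pi / 4))"
      by (rule arcsin_minus) auto
    ultimately show ?thesis
      by (simp add: q_def)
  qed
  moreover have "(y$3)\<^sup>2 \<le> 4 - (1 + c\<^sup>2) * r\<^sup>2"
  proof -
    \<comment> \<open>The unit vector in the direction of the optimal w. Its ball produces the sharp
      height bound plus the square of 2 t - c, which vanishes at the stationary lift and is dropped
      for an arbitrary t.\<close>
    define e :: "real ^ 4" where "e = (\<chi> i. if i = 3 then (c - s) / sqrt 2 else if i = 4 then (c + s) / sqrt 2 else 0)"
    have "e \<in> nonneg_orthant"
      using sc by (auto simp: nonneg_orthant_def e_def abs_less_iff)
    moreover have "norm e = 1"
    proof (rule power2_eq_imp_eq)
      have "(norm e)\<^sup>2 = ((c - s)\<^sup>2 + (c + s)\<^sup>2) / 2"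
        by (simp add: power2_norm_vec sum_4 e_def power_divide)
      also have "\<dots> = c\<^sup>2 + s\<^sup>2"
        by (simp add: power2_eq_square algebra_simps)
      finally show "(norm e)\<^sup>2 = 1\<^sup>2"
        by (simp add: cs)
    qed simp_all
    ultimately obtain t where t: "(\<Sum>i\<in>UNIV. (chart y $ i + t - sqrt 2 * e $ i)\<^sup>2) \<le> 4"
      by (rule U3_ball[OF p])
    have e: "sqrt 2 * e $ 1 = 0" "sqrt 2 * e $ 2 = 0" "sqrt 2 * e $ 3 = c - s" "sqrt 2 * e $ 4 = c + s"
      by (simp_all add: e_def)
    have "(\<Sum>i\<in>UNIV. (chart y $ i + t - sqrt 2 * e $ i)\<^sup>2) =
      (x + c)\<^sup>2 + (2 * t - c)\<^sup>2 + (sqrt 2 * b / 2 + s)\<^sup>2 * 2 + (sqrt 2 * y$3)\<^sup>2 / 2"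
      unfolding sum_4 e chart_nth x_def[symmetric] b_def[symmetric] by (simp add: power2_eq_square field_simps)
    also have "x + c = sqrt 2 * (r * c)"
      by (simp add: xb(1) algebra_simps)
    also have "sqrt 2 * b / 2 + s = sqrt 2 * (r * s) / 2"
      unfolding xb(2) by (simp add: field_simps)
    finally have "2 * (r * c)\<^sup>2 + (2 * t - c)\<^sup>2 + (r * s)\<^sup>2 + (y$3)\<^sup>2 \<le> 4"
      using t by (simp add: power_mult_distrib power_divide)
    then have "2 * (r * c)\<^sup>2 + (r * s)\<^sup>2 + (y$3)\<^sup>2 \<le> 4"
      using zero_le_power2[of "2 * t - c"] by linarith
    moreover have "2 * (r * c)\<^sup>2 + (r * s)\<^sup>2 = (1 + c\<^sup>2) * r\<^sup>2"
    proof -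
      have "2 * (r * c)\<^sup>2 + (r * s)\<^sup>2 = r\<^sup>2 * (c\<^sup>2 + s\<^sup>2) + r\<^sup>2 * c\<^sup>2"
        by (simp add: power_mult_distrib algebra_simps)
      then show ?thesis
        unfolding cs by (simp add: algebra_simps)
    qed
    ultimately show ?thesis by simp
  qed
  moreover have "y = ell_cyl (sqrt 2) 1 1 (sqrt 2) (vector [r, q, y$3])"
    by (simp add: vec_eq_iff forall_3 ell_cyl_def q_sc xb[symmetric]) (simp add: x_def b_def)
  ultimately show ?thesis
    using r q_sc by (intro image_eqI[of _ _ "vector [r, q, y$3]"]) auto
qed

text \<open>The coordinate image lies in the piece and misses at most points of the plane where the
  second coordinate vanishes.\<close>

lemma measure_edge_piece:
  shows "chart -` U3_piece {3, 4} \<in> lmeasurable"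
    and "measure lebesgue (chart -` U3_piece {3, 4}) =
      (48 - 22 * sqrt 2 + 8 * arctan (1 / sqrt 8) - 4 * pi / 3 * sqrt 6
      - 96 * integral {0..1 / sqrt 3} edge_integrand) / 6"
proof -
  let ?G = "ell_cyl (sqrt 2) 1 1 (sqrt 2) `
    {y. sqrt 2 < y$1 \<and> \<bar>y$2\<bar> < pi / 4 \<and> (y$3)\<^sup>2 \<le> 4 - (1 + (cos (y$2))\<^sup>2) * (y$1)\<^sup>2}"
  have sub: "?G \<subseteq> chart -` U3_piece {3, 4}"
    using edge_chart_mem by auto
  have "chart -` U3_piece {3, 4} - ?G \<subseteq> {y. y$2 = 0}"
    using edge_chart_image by blast
  moreover have "negligible {y :: real ^ 3. y$2 = 0}"
    by (rule negligible_standard_hyperplane_cart)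
  ultimately have "negligible (chart -` U3_piece {3, 4} - ?G)"
    by (rule negligible_subset[rotated])
  moreover have "?G - chart -` U3_piece {3, 4} = {}"
    using sub by (simp only: Diff_eq_empty_iff)
  ultimately have neg: "negligible (?G - chart -` U3_piece {3, 4} \<union> (chart -` U3_piece {3, 4} - ?G))"
    by (simp only: Un_empty_left)
  show "chart -` U3_piece {3, 4} \<in> lmeasurable"
    by (rule lmeasurable_negligible_symdiff[OF measure_edge(1) neg])
  show "measure lebesgue (chart -` U3_piece {3, 4}) =
      (48 - 22 * sqrt 2 + 8 * arctan (1 / sqrt 8) - 4 * pi / 3 * sqrt 6
      - 96 * integral {0..1 / sqrt 3} edge_integrand) / 6"
    unfolding measure_edge(2)[symmetric] by (rule measure_negligible_symdiff[OF measure_edge(1) neg])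
qed

lemma measure_U3:
  assumes f: "ones_perp_isometry f"
  shows "measure lebesgue (f -` U3) = 4 * pi / 3 * (4 - sqrt 6) + 24 * (2 - sqrt 2 - arctan (1 / sqrt 8))
    - 96 * integral {0..1 / sqrt 3} edge_integrand"
proof -
  \<comment> \<open>One representative index set per cardinality. \<open>UNIV\<close> stands for
    both sizes 3 and 4, whose pieces are empty.\<close>
  define m where "m k = measure lebesgue (chart -` U3_piece
    (if k = 0 then {} else if k = 1 then {1} else if k = 2 then {3, 4} else UNIV))" for k :: nat
  have base: "chart -` U3_piece N \<in> lmeasurable \<and> measure lebesgue (chart -` U3_piece N) = m (card N)" for N
  proof -
    consider "card N = 0" | "card N = 1" | "card N = 2" | "3 \<le> card N"
      by linarith
    then show ?thesis
    proof cases
      case 1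
      then show ?thesis
        using measure_simplex_piece by (simp add: m_def)
    next
      case 2
      then show ?thesis
        using measure_U3_piece_card[OF ones_perp_isometry_chart _ measure_vertex_piece(1), of N] by (simp add: m_def)
    next
      case 3
      then show ?thesis
        using measure_U3_piece_card[OF ones_perp_isometry_chart _ measure_edge_piece(1), of N] by (simp add: m_def)
    next
      case 4
      then show ?thesis
        using U3_piece_empty[of UNIV] U3_piece_empty[of N] by (auto simp: m_def)
    qed
  qed
  have piece: "f -` U3_piece N \<in> lmeasurable" "measure lebesgue (f -` U3_piece N) = m (card N)" for N
    using ones_perp_isometry_vimage[OF f ones_perp_isometry_chart] base by auto
  have "f -` U3 = (\<Union>N\<in>UNIV. f -` U3_piece N)"
    by (auto simp: U3_piece_def)
  also have "measure lebesgue \<dots> = (\<Sum>N\<in>UNIV. measure lebesgue (f -` U3_piece N))"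
  proof (rule measure_negligible_finite_Union_image)
    have "f -` U3_piece N \<inter> f -` U3_piece N' = {}" if "N \<noteq> N'" for N N'
      using that by (auto simp: U3_piece_def)
    then show "pairwise (\<lambda>N N'. negligible (f -` U3_piece N \<inter> f -` U3_piece N')) UNIV"
      by (simp add: pairwise_def)
  qed (simp_all add: piece)
  also have "\<dots> = (\<Sum>N\<in>(UNIV :: 4 set set). m (card N))"
    by (simp add: piece)
  also have "\<dots> = (\<Sum>k\<in>{..4}. \<Sum>N\<in>{N\<in>(UNIV :: 4 set set). card N = k}. m (card N))"
    by (rule sum.group[symmetric]) (use card_mono[of "UNIV :: 4 set"] in auto)
  also have "\<dots> = (\<Sum>k\<in>{..4}. real (4 choose k) * m k)"
  proof (rule sum.cong[OF refl])
    fix k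
    have "card {N :: 4 set. card N = k} = 4 choose k"
      using n_subsets[of "UNIV :: 4 set" k] by simp
    then show "(\<Sum>N\<in>{N\<in>(UNIV :: 4 set set). card N = k}. m (card N)) = real (4 choose k) * m k"
      by simp
  qed
  also have "\<dots> = m 0 + 4 * m 1 + 6 * m 2"
    using U3_piece_empty[of UNIV] by (simp add: numeral_eq_Suc m_def)
  also have "\<dots> = 2 * sqrt 2 / 3 + 4 * (8 * (pi / 2 - arctan (1 / sqrt 8)) - 8 * pi / 3 - 2 * sqrt 2 / 3)
      + (48 - 22 * sqrt 2 + 8 * arctan (1 / sqrt 8) - 4 * pi / 3 * sqrt 6
      - 96 * integral {0..1 / sqrt 3} edge_integrand)"
    using measure_simplex_piece(2) measure_vertex_piece(2) measure_edge_piece(2) arctan_inverse_sqrt_2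
    by (simp add: m_def)
  finally show ?thesis
    by (simp add: field_simps)
qed

subsection \<open>Decimals\<close>

definition arctan_poly :: "nat \<Rightarrow> real \<Rightarrow> real" where
  "arctan_poly n x = (\<Sum>k<n. (- 1) ^ k * x ^ (2 * k + 1) / (2 * real k + 1))"

text \<open>The signed Taylor remainder vanishes at 0 and has derivative t^(2 n) / (1 + t^2), by the
  geometric sum.\<close>

lemma arctan_poly_le:
  assumes x: "0 \<le> x"
  shows "0 \<le> (- 1) ^ n * (arctan x - arctan_poly n x)"
proof -
  let ?f = "\<lambda>x. (- 1) ^ n * (arctan x - arctan_poly n x)"
  have "?f 0 \<le> ?f x"
  proof (rule DERIV_nonneg_imp_nondecreasing[OF x])
    fix t :: real
    assume "0 \<le> t"
    have "(arctan_poly n has_real_derivative (\<Sum>k<n. (- 1) ^ k * t ^ (2 * k))) (at t)"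
    proof -
      have "((\<lambda>x. (- 1) ^ k * x ^ (2 * k + 1) / (2 * real k + 1)) has_real_derivative (- 1) ^ k * t ^ (2 * k)) (at t)" for k
        by (rule DERIV_cong[OF DERIV_cdivide[OF DERIV_cmult[OF DERIV_pow]]]) (simp add: field_simps)
      then show ?thesis
        unfolding arctan_poly_def by (intro DERIV_sum)
    qed
    moreover have "(\<Sum>k<n. (- 1) ^ k * t ^ (2 * k)) = (\<Sum>k<n. (- t\<^sup>2) ^ k)"
      by (intro sum.cong refl) (simp add: power_mult power_minus[of "t\<^sup>2"])
    moreover have "\<dots> = (1 - (- t\<^sup>2) ^ n) / (1 + t\<^sup>2)"
    proof -
      have "- t\<^sup>2 \<noteq> 1"
        using zero_le_power2[of t] by linarith
      then show ?thesis
        by (subst sum_gp_strict) simp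
    qed
    ultimately have d: "(?f has_real_derivative (- 1) ^ n * (inverse (1 + t\<^sup>2) - (1 - (- t\<^sup>2) ^ n) / (1 + t\<^sup>2))) (at t)"
      by (intro DERIV_cmult DERIV_diff DERIV_arctan) simp
    have "inverse (1 + t\<^sup>2) - (1 - (- t\<^sup>2) ^ n) / (1 + t\<^sup>2) = (- t\<^sup>2) ^ n / (1 + t\<^sup>2)"
      by (simp add: inverse_eq_divide diff_divide_distrib)
    also have "(- 1) ^ n * \<dots> = (t\<^sup>2) ^ n / (1 + t\<^sup>2)"
      by (simp add: power_minus[of "t\<^sup>2"] flip: power_add mult.assoc)
    finally have "0 \<le> (- 1) ^ n * (inverse (1 + t\<^sup>2) - (1 - (- t\<^sup>2) ^ n) / (1 + t\<^sup>2))"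
      by simp
    with d show "\<exists>y. (?f has_real_derivative y) (at t) \<and> 0 \<le> y"
      by blast
  qed
  then show ?thesis
    by (simp add: arctan_poly_def)
qed

lemma arctan_le_poly: "0 \<le> x \<Longrightarrow> odd n \<Longrightarrow> arctan x \<le> arctan_poly n x"
  and poly_le_arctan: "0 \<le> x \<Longrightarrow> even n \<Longrightarrow> arctan_poly n x \<le> arctan x"
  using arctan_poly_le[of x n] by simp_all

text \<open>Machin's formula pi = 16 arctan (1/5) - 4 arctan (1/239), with each arctangent enclosed
  by Taylor polynomials of even and odd length.\<close>

lemma pi_bounds: "3.141592653589793238 \<le> pi" "pi \<le> 3.141592653589793239"
proof -
  have "arctan_poly 14 (1 / 5) \<le> arctan (1 / 5)" "arctan (1 / 5) \<le> arctan_poly 15 (1 / 5)"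
    "arctan_poly 4 (1 / 239) \<le> arctan (1 / 239)" "arctan (1 / 239) \<le> arctan_poly 5 (1 / 239)"
    by (simp_all add: arctan_le_poly poly_le_arctan)
  moreover have "3.141592653589793238 \<le> 16 * arctan_poly 14 (1 / 5) - 4 * arctan_poly 5 (1 / 239)"
    "16 * arctan_poly 15 (1 / 5) - 4 * arctan_poly 4 (1 / 239) \<le> 3.141592653589793239"
    by (simp_all add: arctan_poly_def lessThan_nat_numeral power_divide)
  ultimately show "3.141592653589793238 \<le> pi" "pi \<le> 3.141592653589793239"
    using machin by linarith+
qed

text \<open>The Taylor coefficients of (1 - y)^(-1/2), that is, binomial (2 j, j) / 4^j, in a
  recursive form suited to evaluation.\<close>

primrec inv_sqrt_coeff :: "nat \<Rightarrow> real" where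
  "inv_sqrt_coeff 0 = 1"
| "inv_sqrt_coeff (Suc j) = inv_sqrt_coeff j * (2 * real j + 1) / (2 * real j + 2)"

lemma inv_sqrt_coeff_bounds: "0 \<le> inv_sqrt_coeff j \<and> inv_sqrt_coeff j \<le> 1"
proof (induction j)
  case (Suc j)
  then have "inv_sqrt_coeff j * ((2 * real j + 1) / (2 * real j + 2)) \<le> 1 * 1"
    by (intro mult_mono) auto
  with Suc show ?case by simp
qed simp

lemma inv_sqrt_coeff_gbinomial: "(- 1 / 2 gchoose j) * (- 1) ^ j = inv_sqrt_coeff j"
proof (induction j)
  case (Suc j)
  have "(- 1 / 2 :: real) gchoose Suc j = (- 1 / 2 gchoose j) * (- 1 / 2 - real j) / (real j + 1)"
    by (simp add: gbinomial_prod_rev field_simps)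
  then have "(- 1 / 2 gchoose Suc j) * (- 1) ^ Suc j = ((- 1 / 2 gchoose j) * (- 1 / 2 - real j) / (real j + 1)) * (- 1) ^ Suc j"
    by (simp only:)
  also have "\<dots> = ((- 1 / 2 gchoose j) * (- 1) ^ j) * (- (- 1 / 2 - real j) / (real j + 1))"
    by (simp only: power_Suc times_divide_eq_left times_divide_eq_right mult_minus_left mult_minus_right mult_1 mult.assoc mult.commute mult.left_commute)
  also have "\<dots> = inv_sqrt_coeff (Suc j)"
    unfolding Suc by (simp add: field_simps)
  finally show ?case .
qed simp

text \<open>All coefficients lie between 0 and 1, so the tail of the binomial series is non-negative
  and dominated by a geometric series.\<close>

lemma inverse_sqrt_bounds:
  assumes y: "0 \<le> y" "y < 1"
  shows "(\<Sum>j<n. inv_sqrt_coeff j * y ^ j) \<le> 1 / sqrt (1 - y)"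
    "1 / sqrt (1 - y) \<le> (\<Sum>j<n. inv_sqrt_coeff j * y ^ j) + y ^ n / (1 - y)"
proof -
  have "(\<lambda>j. (- 1 / 2 gchoose j) * (- y) ^ j) sums (1 + - y) powr (- 1 / 2)"
    using y by (intro gen_binomial_real) simp
  moreover have "(- 1 / 2 gchoose j) * (- y) ^ j = inv_sqrt_coeff j * y ^ j" for j
    unfolding inv_sqrt_coeff_gbinomial[symmetric] by (simp add: power_minus[of y])
  moreover have "(1 + - y) powr (- 1 / 2) = 1 / sqrt (1 - y)"
    using y by (simp add: powr_minus_divide powr_half_sqrt)
  ultimately have s: "(\<lambda>j. inv_sqrt_coeff j * y ^ j) sums (1 / sqrt (1 - y))"
    by simp
  then have sm: "summable (\<lambda>j. inv_sqrt_coeff j * y ^ j)" and val: "(\<Sum>j. inv_sqrt_coeff j * y ^ j) = 1 / sqrt (1 - y)"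
    by (simp_all add: sums_iff)
  have nn: "0 \<le> inv_sqrt_coeff j * y ^ j" for j
    using inv_sqrt_coeff_bounds y by simp
  show "(\<Sum>j<n. inv_sqrt_coeff j * y ^ j) \<le> 1 / sqrt (1 - y)"
    unfolding val[symmetric] by (rule sum_le_suminf[OF sm]) (use nn in auto)
  have "(\<Sum>j. inv_sqrt_coeff (j + n) * y ^ (j + n)) \<le> (\<Sum>j. y ^ n * y ^ j)"
  proof (rule suminf_le)
    show "inv_sqrt_coeff (j + n) * y ^ (j + n) \<le> y ^ n * y ^ j" for j
      using mult_right_mono[of "inv_sqrt_coeff (j + n)" 1 "y ^ (j + n)"] inv_sqrt_coeff_bounds[of "j + n"] y
      by (simp add: power_add mult.commute)
    show "summable (\<lambda>j. inv_sqrt_coeff (j + n) * y ^ (j + n))"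
      using sm by (simp add: summable_iff_shift[of "\<lambda>j. inv_sqrt_coeff j * y ^ j"])
    show "summable (\<lambda>j. y ^ n * y ^ j)"
      using y by (intro summable_mult summable_geometric) simp
  qed
  also have "\<dots> = y ^ n / (1 - y)"
    using y by (simp add: suminf_mult suminf_geometric summable_geometric)
  finally show "1 / sqrt (1 - y) \<le> (\<Sum>j<n. inv_sqrt_coeff j * y ^ j) + y ^ n / (1 - y)"
    unfolding val[symmetric] using suminf_split_initial_segment[OF sm, of n] by simp
qed

text \<open>The integral of t^(2 i + 1) / (1 + t^2) from 0 to x, which remains when t^(2 i) arctan t
  is integrated by parts. The recursion splits off t^(2 i + 1).\<close>

primrec arctan_moment_aux :: "nat \<Rightarrow> real \<Rightarrow> real" where
  "arctan_moment_aux 0 = (\<lambda>x. ln (1 + x\<^sup>2) / 2)"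
| "arctan_moment_aux (Suc i) = (\<lambda>x. x ^ (2 * i + 2) / (2 * real i + 2) - arctan_moment_aux i x)"

lemma DERIV_arctan_moment_aux:
  "(arctan_moment_aux i has_real_derivative x ^ (2 * i + 1) / (1 + x\<^sup>2)) (at x)"
proof (induction i)
  case 0
  have "0 < 1 + x\<^sup>2" by (simp add: add_pos_nonneg)
  then have "((\<lambda>x. ln (1 + x\<^sup>2) / 2) has_real_derivative x / (1 + x\<^sup>2)) (at x)"
    by (auto intro!: derivative_eq_intros simp: field_simps)
  then show ?case by simp
next
  case (Suc i)
  have "((\<lambda>x. x ^ (2 * i + 2) / (2 * real i + 2)) has_real_derivative x ^ (2 * i + 1)) (at x)"
    by (rule DERIV_cong[OF DERIV_cdivide[OF DERIV_pow]]) (simp add: field_simps)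
  from DERIV_diff[OF this Suc]
  have "((\<lambda>x. arctan_moment_aux (Suc i) x) has_real_derivative x ^ (2 * i + 1) - x ^ (2 * i + 1) / (1 + x\<^sup>2)) (at x)"
    by simp
  moreover have "x ^ (2 * i + 1) - x ^ (2 * i + 1) / (1 + x\<^sup>2) = x ^ (2 * Suc i + 1) / (1 + x\<^sup>2)"
  proof -
    have "1 + x\<^sup>2 \<noteq> 0" using zero_le_power2[of x] by linarith
    then show ?thesis by (simp add: field_simps power2_eq_square)
  qed
  ultimately show ?case by simp
qed

lemma arctan_moment_aux_0: "arctan_moment_aux i 0 = 0"
  by (induction i) simp_all

lemma arctan_moment_has_integral:
  assumes "0 \<le> b"
  shows "((\<lambda>x. x ^ (2 * i) * arctan x) has_integral
    (b ^ (2 * i + 1) * arctan b - arctan_moment_aux i b) / (2 * real i + 1)) {0..b}"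
proof -
  define F where "F x = (x ^ (2 * i + 1) * arctan x - arctan_moment_aux i x) / (2 * real i + 1)" for x
  have "((\<lambda>x. x ^ (2 * i) * arctan x) has_integral F b - F 0) {0..b}"
  proof (rule fundamental_theorem_of_calculus[OF assms])
    fix x
    have "((\<lambda>x. x ^ (2 * i + 1) * arctan x) has_real_derivative
        (2 * real i + 1) * x ^ (2 * i) * arctan x + x ^ (2 * i + 1) / (1 + x\<^sup>2)) (at x)"
      by (rule DERIV_cong[OF DERIV_mult[OF DERIV_pow DERIV_arctan]]) (simp add: field_simps)
    from DERIV_cdivide[OF DERIV_diff[OF this DERIV_arctan_moment_aux[of i x]], of "2 * real i + 1"]
    have "(F has_real_derivative x ^ (2 * i) * arctan x) (at x)"
      unfolding F_def by simp
    then show "(F has_vector_derivative x ^ (2 * i) * arctan x) (at x within {0..b})"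
      unfolding has_real_derivative_iff_has_vector_derivative[symmetric]
      by (rule has_field_derivative_at_within)
  qed
  then show ?thesis
    by (simp add: F_def arctan_moment_aux_0)
qed

text \<open>The rational part of \<open>arctan_moment_aux i (1 / sqrt 3)\<close>; the rest is a
  multiple of ln (4/3), with a sign that alternates in i.\<close>

primrec moment_tail :: "nat \<Rightarrow> real" where
  "moment_tail 0 = 0"
| "moment_tail (Suc i) = (1 / 3) ^ (i + 1) / (2 * real i + 2) - moment_tail i"

text \<open>Lets the simplifier unfold the recursion at numeral indices when the finite sums are
  evaluated.\<close>

lemma inv_sqrt_coeff_numeral: "inv_sqrt_coeff (numeral k) = inv_sqrt_coeff (pred_numeral k) * (2 * real (pred_numeral k) + 1) / (2 * real (pred_numeral k) + 2)"
  by (simp add: numeral_eq_Suc)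
lemma moment_tail_numeral: "moment_tail (numeral k) = (1 / 3) ^ numeral k / (2 * real (pred_numeral k) + 2) - moment_tail (pred_numeral k)"
  by (simp add: numeral_eq_Suc)


text \<open>First of the three rational sums into which the partial sum with 16 terms splits: the
  coefficient of pi sqrt 3 / 18, the coefficient of ln (4/3) / 2, and the purely rational
  part.\<close>

lemma inv_sqrt_moment_bounds_pi: "1.125568386485437446 \<le> (\<Sum>j<16. inv_sqrt_coeff j * ((1 / 3) ^ (2 * j) / (4 * real j + 1) + (1 / 3) ^ (2 * j + 1) / (4 * real j + 3)))"
  "(\<Sum>j<16. inv_sqrt_coeff j * ((1 / 3) ^ (2 * j) / (4 * real j + 1) + (1 / 3) ^ (2 * j + 1) / (4 * real j + 3))) \<le> 1.125568386485437447"
  by (simp_all add: lessThan_nat_numeral inv_sqrt_coeff_numeral power_divide)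

lemma inv_sqrt_moment_bounds_ln: "0.711220960412893025 \<le> (\<Sum>j<16. inv_sqrt_coeff j * (1 / (4 * real j + 1) - 1 / (4 * real j + 3)))"
   "(\<Sum>j<16. inv_sqrt_coeff j * (1 / (4 * real j + 1) - 1 / (4 * real j + 3))) \<le> 0.711220960412893027"
  by (simp_all add: lessThan_nat_numeral inv_sqrt_coeff_numeral)

lemma inv_sqrt_moment_bounds_rat: "0.049746508318317610 \<le> (\<Sum>j<16. inv_sqrt_coeff j * (moment_tail (2 * j) / (4 * real j + 1) + moment_tail (2 * j + 1) / (4 * real j + 3)))"
  "(\<Sum>j<16. inv_sqrt_coeff j * (moment_tail (2 * j) / (4 * real j + 1) + moment_tail (2 * j + 1) / (4 * real j + 3))) \<le> 0.049746508318317611"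
  by (simp_all add: lessThan_nat_numeral inv_sqrt_coeff_numeral moment_tail_numeral power_divide)

lemma ln_4_3_bounds: "0.287682072451780927 \<le> ln (4 / 3 :: real)" "ln (4 / 3 :: real) \<le> 0.287682072451780928"
  using ln_approx_bounds[of "4 / 3" 11] by (simp_all add: lessThan_nat_numeral power_divide)

text \<open>Twice the integrand is (1 + a^2) arctan a / sqrt (1 - a^4). Expanding the inverse root
  in y = a^4 leaves even moments of the arctangent, so \<open>S n\<close> is the integral of the
  truncated series.\<close>

lemma edge_integral_bounds:
  defines "J \<equiv> 2 * integral {0..1 / sqrt 3} edge_integrand"
  defines "M \<equiv> \<lambda>i. ((1 / sqrt 3) ^ (2 * i + 1) * arctan (1 / sqrt 3) - arctan_moment_aux i (1 / sqrt 3)) / (2 * real i + 1)"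
  defines "S \<equiv> \<lambda>n. \<Sum>j<n. inv_sqrt_coeff j * (M (2 * j) + M (2 * j + 1))"
  shows "S n \<le> J" "J \<le> S n + 1 / (2 * (4 * real n + 2) * 3 ^ (2 * n))"
proof -
  define b where "b = 1 / sqrt 3"
  define P where "P a = (\<Sum>j<n. inv_sqrt_coeff j * (a ^ (2 * (2 * j)) * arctan a + a ^ (2 * (2 * j + 1)) * arctan a))" for a
  have b: "0 \<le> b" "b\<^sup>2 = 1 / 3" "b \<le> 9 / 10"
  proof -
    show b2: "b\<^sup>2 = 1 / 3" by (simp add: b_def power_divide)
    show "b \<le> 9 / 10"
    proof (rule power2_le_imp_le)
      show "b\<^sup>2 \<le> (9 / 10)\<^sup>2"
        unfolding b2 by (simp add: power2_eq_square)
    qed simp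
  qed (simp add: b_def)
  have J: "((\<lambda>a. 2 * edge_integrand a) has_integral J) {0..b}"
  proof -
    have "edge_integrand integrable_on {0..b}"
      using b by (intro integrable_continuous_real continuous_on_subset[OF continuous_on_edge_integrand]) auto
    then show ?thesis
      unfolding J_def b_def[symmetric] by (intro has_integral_mult_right integrable_integral)
  qed
  have P: "(P has_integral S n) {0..b}"
    unfolding P_def S_def M_def b_def[symmetric]
    by (intro has_integral_sum has_integral_mult_right has_integral_add arctan_moment_has_integral b) auto
  have pw: "P a \<le> 2 * edge_integrand a \<and> 2 * edge_integrand a \<le> P a + 3 / 2 * a ^ (4 * n + 1)" if a: "a \<in> {0..b}" for a
  proof -
    have "a\<^sup>2 \<le> b\<^sup>2"
      using a by (intro power_mono) auto
    then have a2: "0 \<le> a\<^sup>2" "a\<^sup>2 \<le> 1 / 3"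
      by (simp_all add: b(2))
    then have "(a\<^sup>2)\<^sup>2 \<le> (1 / 3)\<^sup>2"
      by (intro power_mono) auto
    define y where "y = a ^ 4"
    have y: "0 \<le> y" "y \<le> 1 / 9" "y = (a\<^sup>2)\<^sup>2"
    proof -
      show "y = (a\<^sup>2)\<^sup>2" by (simp add: y_def)
      then show "y \<le> 1 / 9" "0 \<le> y"
        using \<open>(a\<^sup>2)\<^sup>2 \<le> (1 / 3)\<^sup>2\<close> by (simp_all add: power_divide)
    qed
    have at: "0 \<le> arctan a" "arctan a \<le> a"
      using a arctan_le_self[of a] by auto
    have "(1 + a\<^sup>2) / (1 - a\<^sup>2) = (1 + a\<^sup>2)\<^sup>2 / (1 - y)"
    proof -
      have "1 - y = (1 - a\<^sup>2) * (1 + a\<^sup>2)"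
        by (simp add: y(3) power2_eq_square algebra_simps)
      then show ?thesis
        using a2 by (simp add: power2_eq_square)
    qed
    then have eq: "2 * edge_integrand a = 1 / sqrt (1 - y) * ((1 + a\<^sup>2) * arctan a)"
      using a2 by (simp add: edge_integrand_eq real_sqrt_divide)
    have Peq: "P a = (\<Sum>j<n. inv_sqrt_coeff j * y ^ j) * ((1 + a\<^sup>2) * arctan a)"
    proof -
      have "y ^ j = a ^ (2 * (2 * j))" for j
        by (simp add: y_def mult.commute flip: power_mult)
      then show ?thesis
        unfolding P_def sum_distrib_right
        by (intro sum.cong refl) (simp add: power_add power2_eq_square algebra_simps)
    qed
    define Z where "Z = (1 + a\<^sup>2) * arctan a"
    have nn: "0 \<le> Z"
      using at by (simp add: Z_def)
    have y1: "y < 1" using y by simp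
    note i = inverse_sqrt_bounds[OF y(1) y1, of n]
    \<comment> \<open>On the interval a^2 is at most 1/3 and y at most 1/9, which gives the factors
      4/3 and 9/8; arctan a is bounded by a. Their product is the constant 3/2.\<close>
    have "y ^ n / (1 - y) * Z \<le> (y ^ n * (9 / 8)) * (4 / 3 * a)"
      unfolding Z_def
    proof (intro mult_mono)
      have "1 / (1 - y) \<le> 9 / 8"
        using y by (simp add: field_simps)
      then show "y ^ n / (1 - y) \<le> y ^ n * (9 / 8)"
        using mult_left_mono[of "1 / (1 - y)" "9 / 8" "y ^ n"] y by simp
    qed (use y a2 a at in auto)
    also have "\<dots> = 3 / 2 * a ^ (4 * n + 1)"
      by (simp add: y_def flip: power_mult)
    finally have "P a \<le> 2 * edge_integrand a" "2 * edge_integrand a \<le> P a + 3 / 2 * a ^ (4 * n + 1)"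
      using mult_right_mono[OF i(1) nn] mult_right_mono[OF i(2) nn, unfolded distrib_right]
      unfolding eq Peq Z_def[symmetric] by linarith+
    then show ?thesis ..
  qed
  show "S n \<le> J"
    using has_integral_le[OF P J] pw by blast
  have R: "((\<lambda>a. 3 / 2 * a ^ (4 * n + 1)) has_integral 1 / (2 * (4 * real n + 2) * 3 ^ (2 * n))) {0..b}"
  proof -
    have "((\<lambda>a. a ^ (4 * n + 1)) has_integral b ^ (4 * n + 2) / (4 * real n + 2) - 0 ^ (4 * n + 2) / (4 * real n + 2)) {0..b}"
    proof (rule fundamental_theorem_of_calculus[OF b(1)])
      fix a
      have "((\<lambda>a. a ^ (4 * n + 2) / (4 * real n + 2)) has_real_derivative a ^ (4 * n + 1)) (at a)"
        by (rule DERIV_cong[OF DERIV_cdivide[OF DERIV_pow]]) (simp add: field_simps)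
      then show "((\<lambda>a. a ^ (4 * n + 2) / (4 * real n + 2)) has_vector_derivative a ^ (4 * n + 1)) (at a within {0..b})"
        unfolding has_real_derivative_iff_has_vector_derivative[symmetric]
        by (rule has_field_derivative_at_within)
    qed
    from has_integral_mult_right[OF this, of "3 / 2"]
    have "((\<lambda>a. 3 / 2 * a ^ (4 * n + 1)) has_integral 3 / 2 * (b ^ (4 * n + 2) / (4 * real n + 2))) {0..b}"
      by simp
    moreover have "b ^ (4 * n + 2) = 1 / 3 * (1 / 3) ^ (2 * n)"
    proof -
      have "b ^ (4 * n + 2) = (b\<^sup>2) ^ (2 * n + 1)"
        unfolding power_mult[symmetric] by (simp add: algebra_simps)
      then show ?thesis by (simp add: b(2))
    qed
    moreover have "3 / 2 * (1 / 3 * (1 / 3) ^ (2 * n) / (4 * real n + 2)) = 1 / (2 * (4 * real n + 2) * 3 ^ (2 * n))"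
      by (simp add: power_divide)
    ultimately show ?thesis
      by (simp only:)
  qed
  show "J \<le> S n + 1 / (2 * (4 * real n + 2) * 3 ^ (2 * n))"
    by (rule has_integral_le[OF J has_integral_add[OF P R]]) (use pw in blast)
qed

lemma arctan_moment_aux_inverse_sqrt_3:
  "arctan_moment_aux i (1 / sqrt 3) = (- 1) ^ i * (ln (4 / 3) / 2) + moment_tail i"
proof (induction i)
  case (Suc i)
  have "(1 / sqrt 3) ^ (2 * i + 2) = (1 / 3) ^ (i + 1)"
    using power_mult[of "1 / sqrt 3" 2 "i + 1"] by (simp add: power_divide)
  then show ?case
    unfolding arctan_moment_aux.simps Suc by simp
qed (simp add: power_divide)

lemma edge_integral_numeric:
  "0.18820993571855563 \<le> 2 * integral {0..1 / sqrt 3} edge_integrand"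
  "2 * integral {0..1 / sqrt 3} edge_integrand \<le> 0.18820993571855566"
proof -
  define lg where "lg = ln (4 / 3 :: real) / 2"
  define q where "q = pi * sqrt 3 / 18"
  define R1 where "R1 = (\<Sum>j<16. inv_sqrt_coeff j * ((1 / 3) ^ (2 * j) / (4 * real j + 1) + (1 / 3) ^ (2 * j + 1) / (4 * real j + 3)))"
  define R2 where "R2 = (\<Sum>j<16. inv_sqrt_coeff j * (1 / (4 * real j + 1) - 1 / (4 * real j + 3)))"
  define R3 where "R3 = (\<Sum>j<16. inv_sqrt_coeff j * (moment_tail (2 * j) / (4 * real j + 1) + moment_tail (2 * j + 1) / (4 * real j + 3)))"
  define M where "M i = ((1 / sqrt 3) ^ (2 * i + 1) * arctan (1 / sqrt 3) - arctan_moment_aux i (1 / sqrt 3)) / (2 * real i + 1)" for i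
  have M: "M i = (q * (1 / 3) ^ i - (- 1) ^ i * lg - moment_tail i) / (2 * real i + 1)" for i
  proof -
    have at3: "arctan (1 / sqrt 3) = pi / 6"
      by (rule arctan_unique) (auto simp: tan_30)
    have pw: "(1 / sqrt 3) ^ (2 * i + 1) = (1 / 3) ^ i * (sqrt 3 / 3)"
    proof -
      have "1 / sqrt 3 = sqrt 3 / 3"
        by (simp add: field_simps)
      moreover have "(1 / sqrt 3) ^ (2 * i) = (1 / 3) ^ i"
        using power_mult[of "1 / sqrt 3" 2 i] by (simp add: power_divide)
      ultimately show ?thesis
        by (simp only: power_add power_one_right)
    qed
    show ?thesis
      unfolding M_def arctan_moment_aux_inverse_sqrt_3 at3 pw lg_def q_def by (simp add: algebra_simps)
  qed
  have "(\<Sum>j<16. inv_sqrt_coeff j * (M (2 * j) + M (2 * j + 1))) = (\<Sum>j<16. q * (inv_sqrt_coeff j * ((1 / 3) ^ (2 * j) / (4 * real j + 1) + (1 / 3) ^ (2 * j + 1) / (4 * real j + 3)))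
    - lg * (inv_sqrt_coeff j * (1 / (4 * real j + 1) - 1 / (4 * real j + 3)))
    - inv_sqrt_coeff j * (moment_tail (2 * j) / (4 * real j + 1) + moment_tail (2 * j + 1) / (4 * real j + 3)))"
  proof (rule sum.cong[OF refl])
    fix j
    have e: "2 * real (2 * j) + 1 = 4 * real j + 1" "2 * real (2 * j + 1) + 1 = 4 * real j + 3"
      by simp_all
    have s: "(- 1 :: real) ^ (2 * j) = 1" "(- 1 :: real) ^ (2 * j + 1) = - 1"
      by simp_all
    show "inv_sqrt_coeff j * (M (2 * j) + M (2 * j + 1)) = q * (inv_sqrt_coeff j * ((1 / 3) ^ (2 * j) / (4 * real j + 1) + (1 / 3) ^ (2 * j + 1) / (4 * real j + 3)))
      - lg * (inv_sqrt_coeff j * (1 / (4 * real j + 1) - 1 / (4 * real j + 3)))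
      - inv_sqrt_coeff j * (moment_tail (2 * j) / (4 * real j + 1) + moment_tail (2 * j + 1) / (4 * real j + 3))"
      unfolding M e s diff_divide_distrib by (simp only: algebra_simps) (simp add: algebra_simps)
  qed
  also have "\<dots> = q * R1 - lg * R2 - R3"
    by (simp only: R1_def R2_def R3_def sum_subtractf sum_distrib_left)
  finally have S: "(\<Sum>j<16. inv_sqrt_coeff j * (M (2 * j) + M (2 * j + 1))) = q * R1 - lg * R2 - R3" .
  have sqrt3: "1.732050807568877293 \<le> sqrt 3" "sqrt 3 \<le> 1.732050807568877294"
    by (rule real_le_rsqrt real_le_lsqrt; simp add: power2_eq_square)+
  have q: "3.141592653589793238 * 1.732050807568877293 / 18 \<le> q" "q \<le> 3.141592653589793239 * 1.732050807568877294 / 18"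
    unfolding q_def using pi_bounds sqrt3 by (intro divide_right_mono mult_mono; simp)+
  have l: "0.1438410362258904635 \<le> lg" "lg \<le> 0.143841036225890464"
    using ln_4_3_bounds by (simp_all add: lg_def)
  note r = inv_sqrt_moment_bounds_pi[folded R1_def] inv_sqrt_moment_bounds_ln[folded R2_def] inv_sqrt_moment_bounds_rat[folded R3_def]
  have "(3.141592653589793238 * 1.732050807568877293 / 18) * 1.125568386485437446 \<le> q * R1"
    "q * R1 \<le> (3.141592653589793239 * 1.732050807568877294 / 18) * 1.125568386485437447"
    by (rule mult_mono; use q r in \<open>linarith | simp\<close>)+
  moreover have "0.1438410362258904635 * 0.711220960412893025 \<le> lg * R2" "lg * R2 \<le> 0.143841036225890464 * 0.711220960412893027"
    by (rule mult_mono; use l r in \<open>linarith | simp\<close>)+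
  \<comment> \<open>With n = 16 the error term has denominator 132 = 2 (4 * 16 + 2) times 3^32 and
    is below 5e-18.\<close>
  moreover have "q * R1 - lg * R2 - R3 \<le> 2 * integral {0..1 / sqrt 3} edge_integrand"
    "2 * integral {0..1 / sqrt 3} edge_integrand \<le> q * R1 - lg * R2 - R3 + 1 / (132 * 3 ^ 32)"
    using edge_integral_bounds[of 16] unfolding M_def[symmetric] S by simp_all
  ultimately show "0.18820993571855563 \<le> 2 * integral {0..1 / sqrt 3} edge_integrand"
    "2 * integral {0..1 / sqrt 3} edge_integrand \<le> 0.18820993571855566"
    using r by simp_all
qed

lemma sqrt_2_bounds: "1.41421356237309504 \<le> sqrt 2" "sqrt 2 \<le> 1.41421356237309505"
  by (rule real_le_rsqrt real_le_lsqrt; simp add: power2_eq_square)+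

text \<open>As 1 / sqrt 8 = sqrt 2 / 4, each Taylor polynomial is sqrt 2 / 4 times a rational sum
  \<open>A n\<close>, and the only irrational factor left is sqrt 2.\<close>

lemma arctan_inverse_sqrt_8_bounds:
  "0.33983690945412193 \<le> arctan (1 / sqrt 8)" "arctan (1 / sqrt 8) \<le> 0.33983690945412195"
proof -
  define A where "A n = (\<Sum>k<n. (- 1) ^ k * (1 / 8) ^ k / (2 * real k + 1))" for n
  have A: "arctan_poly n (1 / sqrt 8) = sqrt 2 / 4 * A n" for n
  proof -
    have "1 / sqrt 8 = sqrt 2 / 4"
      using real_sqrt_mult[of 4 2] by (simp add: field_simps)
    moreover have "(1 / sqrt 8) ^ (2 * k + 1) = 1 / sqrt 8 * (1 / 8) ^ k" for k
      using power_mult[of "1 / sqrt 8" 2 k] by (simp add: power_divide)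
    ultimately have pw: "(1 / sqrt 8) ^ (2 * k + 1) = sqrt 2 / 4 * (1 / 8) ^ k" for k
      by (simp only:)
    show ?thesis
      unfolding arctan_poly_def A_def sum_distrib_left pw by (intro sum.cong refl) simp
  qed
  have "sqrt 2 / 4 * A 20 \<le> arctan (1 / sqrt 8)" "arctan (1 / sqrt 8) \<le> sqrt 2 / 4 * A 21"
    unfolding A[symmetric] by (simp_all add: poly_le_arctan arctan_le_poly)
  moreover have A': "0.961203932689953457 \<le> A 20" "A 21 \<le> 0.961203932689953458" "0 \<le> A 21"
    by (simp_all add: A_def lessThan_nat_numeral power_divide)
  moreover note sqrt2 = sqrt_2_bounds
  moreover have "1.41421356237309504 / 4 * 0.961203932689953457 \<le> sqrt 2 / 4 * A 20"
    by (rule mult_mono) (use A' sqrt2 in simp_all)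
  moreover have "sqrt 2 / 4 * A 21 \<le> 1.41421356237309505 / 4 * 0.961203932689953458"
    by (rule mult_mono) (use A' sqrt2 in simp_all)
  ultimately show "0.33983690945412193 \<le> arctan (1 / sqrt 8)" "arctan (1 / sqrt 8) \<le> 0.33983690945412195"
    by simp_all
qed

theorem theorem1p2:
  fixes f :: "real ^ 3 \<Rightarrow> real ^ 4"
  assumes "ones_perp_isometry f"
  shows "0.8029702551499 \<le> measure lebesgue (f -` U3) / measure lebesgue (cball 0 1 :: (real ^ 3) set)
       \<and> measure lebesgue (f -` U3) / measure lebesgue (cball 0 1 :: (real ^ 3) set) < 0.8029702551500
       \<and> measure lebesgue (f -` U3) =
           4 * pi / 3 * (4 - sqrt 6) + 24 * (2 - sqrt 2 - arctan (1 / sqrt 8))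
           - 96 * integral {0..1 / sqrt 3}
               (\<lambda>a. sqrt ((1 + a\<^sup>2) / (1 - a\<^sup>2)) * arctan (a / (sqrt (1 + a\<^sup>2) + 1)))"
proof -
  define A where "A = arctan (1 / sqrt 8)"
  define J where "J = 2 * integral {0..1 / sqrt 3} edge_integrand"
  have ball: "measure lebesgue (cball 0 1 :: (real ^ 3) set) = 4 * pi / 3"
    by (simp add: measure_completion content_cball eval_unit_ball_vol)
  have vol: "measure lebesgue (f -` U3) = 4 * pi / 3 * (4 - sqrt 6) + 24 * (2 - sqrt 2 - A) - 48 * J"
    using measure_U3[OF assms] by (simp add: A_def J_def)
  have pi6: "4 * pi / 3 * (4 - sqrt 6) = 16 / 3 * pi - 4 / 3 * (pi * sqrt 6)"
    by (simp add: field_simps)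
  note sqrt2 = sqrt_2_bounds
  have sqrt6: "2.449489742783178098 \<le> sqrt 6" "sqrt 6 \<le> 2.449489742783178099"
    by (rule real_le_rsqrt real_le_lsqrt; simp add: power2_eq_square)+
  have A: "0.33983690945412193 \<le> A" "A \<le> 0.33983690945412195"
    using arctan_inverse_sqrt_8_bounds by (simp_all add: A_def)
  have J: "0.18820993571855563 \<le> J" "J \<le> 0.18820993571855566"
    using edge_integral_numeric by (simp_all add: J_def)
  \<comment> \<open>The claimed ratio is subtracted inside the factor of pi, so that all terms with
    pi form one product of positive factors, bounded monotonically. The remaining constants enter
    with factors 24 and 48, and their error stays well below the 1e-13 needed.\<close>
  have "3.141592653589793238 * (4 - 2.449489742783178099 - 0.8029702551499) \<le> pi * (4 - sqrt 6 - 0.8029702551499)"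
    by (rule mult_mono) (use pi_bounds sqrt6 in simp_all)
  then have "3.141592653589793238 * (4 - 2.449489742783178099 - 0.8029702551499) \<le> 4 * pi - pi * sqrt 6 - 0.8029702551499 * pi"
    by (simp only: right_diff_distrib mult.commute)
  then have lo: "0.8029702551499 * (4 * pi / 3) \<le> measure lebesgue (f -` U3)"
    unfolding vol pi6 using A J sqrt2 by simp
  have "pi * (4 - sqrt 6 - 0.80297025515) \<le> 3.141592653589793239 * (4 - 2.449489742783178098 - 0.80297025515)"
    by (rule mult_mono) (use pi_bounds sqrt6 in simp_all)
  then have "4 * pi - pi * sqrt 6 - 0.80297025515 * pi \<le> 3.141592653589793239 * (4 - 2.449489742783178098 - 0.80297025515)"
    by (simp only: right_diff_distrib mult.commute)
  then have hi: "measure lebesgue (f -` U3) < 0.80297025515 * (4 * pi / 3)"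
    unfolding vol pi6 using A J sqrt2 by simp
  have "measure lebesgue (f -` U3) =
           4 * pi / 3 * (4 - sqrt 6) + 24 * (2 - sqrt 2 - arctan (1 / sqrt 8))
           - 96 * integral {0..1 / sqrt 3}
               (\<lambda>a. sqrt ((1 + a\<^sup>2) / (1 - a\<^sup>2)) * arctan (a / (sqrt (1 + a\<^sup>2) + 1)))"
    using measure_U3[OF assms] unfolding edge_integrand_def[abs_def] .
  with lo hi show ?thesis
    unfolding ball by (simp add: pos_le_divide_eq pos_divide_less_eq)
qed

end
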